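(* Consider a bandit with $n$ arms with mean rewards in $[0,1]$, of which $m$ are best arms (having the maximal mean $\mu^\star$), where pulling an arm yields its mean plus i.i.d. $1$-subgaussian noise. Let $T$ be the time horizon and assume there is $\gamma\in[0,1]$ with $n/m\le T^\gamma$. Consider the algorithm that subsamples $K$ arms uniformly at random without replacement from the $n$ arms and runs Greedy on them, and assume $n$ is large enough for the following subsampling to be possible. Then: (i) if $T^{1-3\gamma}\le\log T$ (in particular if $\gamma\ge 1/3$ and $T\ge2$), choosing $K=2T^{2\gamma}\log T$ gives $R_T\le 14\,T^{\gamma+1/2}\log T+2$; (ii) otherwise, choosing $K=2\sqrt{T^{1+\gamma}\log T}$ gives $R_T\le 14\,T^{(3+\gamma)/4}\sqrt{\log T}+2$.
   Context: The Greedy algorithm on a finite set of arms: at each round it pulls an arm with the highest empirical mean of the rewards observed so far, with the convention $0/0=\infty$ (each arm is pulled once initially). The regret is $R_T=T\mu^\star-\mathbb E\big[\sum_{t=1}^T\mu_{A_t}\big]$, where $\mu_{A_t}$ is the mean of the arm pulled at round $t$ and the expectation includes the randomness of the subsampling. *)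

theory Defs
  imports "HOL-Probability.Probability"
begin

text \<open>Bandit model. Arms are natural numbers; the arms of an instance with n arms are
 those in the set lessThan n. Rewards use the reward-table model: X i s is the reward
 obtained at the (s+1)-th pull of arm i.\<close>

definition subgaussian :: "'a measure \<Rightarrow> real \<Rightarrow> ('a \<Rightarrow> real) \<Rightarrow> bool" where
  "subgaussian M \<sigma> Z \<longleftrightarrow>
     Z \<in> borel_measurable M \<and>
     (\<forall>l::real. integrable M (\<lambda>x. exp (l * Z x)) \<and>
        (\<integral>x. exp (l * Z x) \<partial>M) \<le> exp (l\<^sup>2 * \<sigma>\<^sup>2 / 2))"

definition pulls :: "nat list \<Rightarrow> nat \<Rightarrow> nat" where
  "pulls h i = length (filter (\<lambda>j. j = i) h)"

definition emp_mean :: "(nat \<Rightarrow> nat \<Rightarrow> real) \<Rightarrow> nat list \<Rightarrow> nat \<Rightarrow> ereal" where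
  "emp_mean X h i =
     (if pulls h i = 0 then \<infinity>
      else ereal ((\<Sum>s<pulls h i. X i s) / real (pulls h i)))"

definition greedy_maximizers :: "nat set \<Rightarrow> (nat \<Rightarrow> nat \<Rightarrow> real) \<Rightarrow> nat list \<Rightarrow> nat set" where
  "greedy_maximizers S X h = {i \<in> S. \<forall>j\<in>S. emp_mean X h j \<le> emp_mean X h i}"

definition valid_tiebreak :: "(nat list \<Rightarrow> nat set \<Rightarrow> nat) \<Rightarrow> bool" where
  "valid_tiebreak tb \<longleftrightarrow> (\<forall>h A. finite A \<and> A \<noteq> {} \<longrightarrow> tb h A \<in> A)"

fun greedy_hist :: "(nat list \<Rightarrow> nat set \<Rightarrow> nat) \<Rightarrow> nat set \<Rightarrow> (nat \<Rightarrow> nat \<Rightarrow> real) \<Rightarrow> nat \<Rightarrow> nat list" where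
  "greedy_hist tb S X 0 = []"
| "greedy_hist tb S X (Suc t) =
     (let h = greedy_hist tb S X t in h @ [tb h (greedy_maximizers S X h)])"

definition best_mean :: "nat \<Rightarrow> (nat \<Rightarrow> real) \<Rightarrow> real" where
  "best_mean n \<mu> = Max (\<mu> ` {..<n})"

definition num_best :: "nat \<Rightarrow> (nat \<Rightarrow> real) \<Rightarrow> nat" where
  "num_best n \<mu> = card {i. i < n \<and> \<mu> i = best_mean n \<mu>}"

text \<open>Regret of subsampled Greedy: a uniformly random K-subset S of the n arms is drawn
 independently of the noise, then Greedy is run on S for T rounds; noise eps i s is the noise
 of the (s+1)-th pull of arm i.\<close>
definition subsampled_greedy_regret ::
  "'a measure \<Rightarrow> (nat \<Rightarrow> nat \<Rightarrow> 'a \<Rightarrow> real) \<Rightarrow> nat \<Rightarrow> (nat \<Rightarrow> real) \<Rightarrow>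
   (nat list \<Rightarrow> nat set \<Rightarrow> nat) \<Rightarrow> nat \<Rightarrow> nat \<Rightarrow> real" where
  "subsampled_greedy_regret M eps n \<mu> tb K T =
     real T * best_mean n \<mu> -
     measure_pmf.expectation (pmf_of_set {S. S \<subseteq> {..<n} \<and> card S = K})
       (\<lambda>S. \<integral>\<omega>. (\<Sum>t<T. \<mu> (greedy_hist tb S (\<lambda>i s. \<mu> i + eps i s \<omega>) T ! t)) \<partial>M)"

end

theory Submission
  imports Defs
begin

text \<open>Let \<open>B\<close> be the set of subsampled best arms. Up to an event of probability at most
 \<open>exp (- card B * \<delta>\<^sup>2 / 2)\<close>, some arm of \<open>B\<close> has all its empirical means above \<open>\<mu>* - \<delta>\<close>; on the complement,
 Greedy pulls an arm of gap \<open>\<Delta>\<close> again only when its empirical mean exceeds its own mean by \<open>\<Delta> - \<delta>\<close>.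
 By the Chernoff bound, an arm with \<open>\<Delta> > 3 * \<delta>\<close> then costs at most \<open>1 + 3 / (2 * \<delta>)\<close>, and all other
 arms together cost at most \<open>3 * \<delta> * T\<close>. Averaging over the subsample, the failure probability becomes
 \<open>exp (- (K * m / n) * (1 - exp (- \<delta>\<^sup>2 / 2)))\<close>, and \<open>\<delta> = sqrt (K / T)\<close>, up to rounding of \<open>K\<close>,
 makes it at most \<open>1 / T\<close>.\<close>

section \<open>Uniform subsets\<close>

text \<open>Removing one element from a ground set of size \<open>N\<close> multiplies the number of
  \<open>k\<close>-subsets by \<open>1 - k / N\<close>, which is at most \<open>1 - k / n\<close> as
  \<open>N \<le> n\<close>. After division by \<open>n choose k\<close> this bounds the chance that
  a uniform \<open>k\<close>-subset avoids \<open>r\<close> given elements.\<close>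

lemma binomial_diff_le:
  assumes "k \<le> n" "r \<le> n" "0 < n"
  shows "real ((n - r) choose k) \<le> (1 - real k / real n) ^ r * real (n choose k)"
  using assms(2)
proof (induction r)
  case (Suc r)
  define N where "N = n - r"
  have N: "0 < N" "N \<le> n" "n - Suc r = N - 1" using Suc.prems by (auto simp: N_def)
  have p: "0 \<le> 1 - real k / real n" using assms by (simp add: field_simps)
  have "real ((N - 1) choose k) \<le> (1 - real k / real n) * real (N choose k)"
  proof (cases "k \<le> N")
    case True
    have "real (N - k) * real (N choose k) = real N * real ((N - 1) choose k)"
      by (metis binomial_absorb_comp of_nat_mult)
    then have "real ((N - 1) choose k) = (1 - real k / real N) * real (N choose k)"
      using N True by (simp add: field_simps of_nat_diff)
    moreover have "real k / real n \<le> real k / real N"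
      using N by (intro divide_left_mono) auto
    ultimately show ?thesis by (simp add: mult_right_mono)
  qed (use N p in \<open>simp add: binomial_eq_0\<close>)
  also have "\<dots> \<le> (1 - real k / real n) * ((1 - real k / real n) ^ r * real (n choose k))"
    using Suc p by (intro mult_left_mono) (auto simp: N_def)
  finally show ?case by (simp add: N(3) mult.assoc)
qed simp

text \<open>The power \<open>q ^ card (S \<inter> B)\<close> is the probability that \<open>S\<close> misses the random subset of \<open>B\<close>
 keeping each element with probability \<open>1 - q\<close>; a fixed set of \<open>r\<close> elements is missed with
 probability at most \<open>(1 - k / n) ^ r\<close>.\<close>
lemma hypergeometric_pgf_le:
  fixes q :: real
  assumes B: "B \<subseteq> {..<n}" and k: "k \<le> n" and n: "0 < n" and q: "0 \<le> q" "q \<le> 1"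
  shows "(\<Sum>S | S \<subseteq> {..<n} \<and> card S = k. q ^ card (S \<inter> B))
    \<le> real (n choose k) * exp (- (real k * (real (card B) / real n) * (1 - q)))"
proof -
  let ?F = "{S. S \<subseteq> {..<n} \<and> card S = k}"
  let ?m = "card B"
  have finB: "finite B" using B finite_subset by blast
  have finF: "finite ?F" by simp
  have expand: "q ^ card (S \<inter> B)
      = (\<Sum>R\<in>Pow B. ((1 - q) ^ card R * q ^ card (B - R)) * (if S \<inter> R = {} then 1 else 0))" for S
  proof -
    have "q ^ card (S \<inter> B) = (\<Prod>i\<in>B. if i \<in> S then q else 1)"
      using finB by (simp add: prod.If_cases Int_commute Int_def)
    \<comment> \<open>Each factor becomes a sum, so that \<open>prod_add\<close> expands the product
      over the subsets \<open>R\<close> of \<open>B\<close>. A term vanishes as soon as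
      \<open>R\<close> meets \<open>S\<close>, because of the factor 0.\<close>
    also have "\<dots> = (\<Prod>i\<in>B. (if i \<in> S then 0 else 1 - q) + q)"
      by (intro prod.cong) auto
    also have "\<dots> = (\<Sum>R\<in>Pow B. (\<Prod>i\<in>R. if i \<in> S then 0 else 1 - q) * (\<Prod>i\<in>B - R. q))"
      by (rule prod_add[OF finB])
    also have "\<dots> = (\<Sum>R\<in>Pow B. ((1 - q) ^ card R * q ^ card (B - R)) * (if S \<inter> R = {} then 1 else 0))"
    proof (intro sum.cong refl)
      fix R assume "R \<in> Pow B"
      then have "finite R" using finB finite_subset by auto
      have "(\<Prod>i\<in>R. if i \<in> S then 0 else 1 - q) = (if S \<inter> R = {} then (1 - q) ^ card R else 0)"
      proof (cases "S \<inter> R = {}")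
        case True
        then have "(\<Prod>i\<in>R. if i \<in> S then 0 else 1 - q) = (\<Prod>i\<in>R. 1 - q)"
          by (intro prod.cong) auto
        with True show ?thesis by simp
      next
        case False
        with \<open>finite R\<close> show ?thesis by (auto intro!: prod_zero)
      qed
      then show "(\<Prod>i\<in>R. if i \<in> S then 0 else 1 - q) * (\<Prod>i\<in>B - R. q)
          = ((1 - q) ^ card R * q ^ card (B - R)) * (if S \<inter> R = {} then 1 else 0)" by simp
    qed
    finally show ?thesis .
  qed
  have avoid: "(\<Sum>S\<in>?F. if S \<inter> R = {} then 1 else 0)
      \<le> (1 - real k / real n) ^ card R * real (n choose k)" if "R \<in> Pow B" for R
  proof -
    have R: "R \<subseteq> {..<n}" using that B by auto
    have "(\<Sum>S\<in>?F. if S \<inter> R = {} then 1 else 0) = real (card {S\<in>?F. S \<inter> R = {}})"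
      by (subst sum.inter_filter[OF finF, symmetric]) simp
    also have "{S\<in>?F. S \<inter> R = {}} = {S. S \<subseteq> {..<n} - R \<and> card S = k}" by auto
    also have "card \<dots> = card ({..<n} - R) choose k" by (intro n_subsets) auto
    also have "card ({..<n} - R) = n - card R"
      using R by (simp add: card_Diff_subset finite_subset)
    also have "real ((n - card R) choose k) \<le> (1 - real k / real n) ^ card R * real (n choose k)"
      using card_mono[OF _ R] k n by (intro binomial_diff_le) auto
    finally show ?thesis .
  qed
  have "(\<Sum>S\<in>?F. q ^ card (S \<inter> B))
      = (\<Sum>R\<in>Pow B. ((1 - q) ^ card R * q ^ card (B - R)) * (\<Sum>S\<in>?F. if S \<inter> R = {} then 1 else 0))"
    unfolding expand sum_distrib_left by (rule sum.swap)
  also have "\<dots> \<le> (\<Sum>R\<in>Pow B. ((1 - q) ^ card R * q ^ card (B - R)) *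
      ((1 - real k / real n) ^ card R * real (n choose k)))"
    using q avoid by (intro sum_mono mult_left_mono) auto
  also have "\<dots> = real (n choose k) *
      (\<Sum>R\<in>Pow B. (\<Prod>i\<in>R. (1 - q) * (1 - real k / real n)) * (\<Prod>i\<in>B - R. q))"
    by (simp add: sum_distrib_left power_mult_distrib mult_ac)
  \<comment> \<open>The same expansion read backwards: each element of \<open>R\<close> has absorbed
    one factor \<open>1 - k / n\<close> from the avoidance bound.\<close>
  also have "(\<Sum>R\<in>Pow B. (\<Prod>i\<in>R. (1 - q) * (1 - real k / real n)) * (\<Prod>i\<in>B - R. q))
      = (\<Prod>i\<in>B. (1 - q) * (1 - real k / real n) + q)"
    by (rule prod_add[OF finB, symmetric])
  also have "\<dots> = ((1 - q) * (1 - real k / real n) + q) ^ ?m" by simp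
  also have "\<dots> \<le> exp (- (real k / real n * (1 - q))) ^ ?m"
  proof (rule power_mono)
    have "(1 - q) * (1 - real k / real n) + q = 1 + - (real k / real n * (1 - q))"
      by (simp add: algebra_simps)
    also have "\<dots> \<le> exp (- (real k / real n * (1 - q)))" by (rule exp_ge_add_one_self)
    finally show "(1 - q) * (1 - real k / real n) + q \<le> exp (- (real k / real n * (1 - q)))" .
    show "0 \<le> (1 - q) * (1 - real k / real n) + q"
      using q k n by (intro add_nonneg_nonneg mult_nonneg_nonneg) (auto simp: field_simps)
  qed
  also have "\<dots> = exp (- (real k * (real ?m / real n) * (1 - q)))"
    by (simp add: exp_of_nat_mult[symmetric] mult_ac)
  finally show ?thesis by (simp add: mult_left_mono)
qed

section \<open>Sums of independent subgaussian noise\<close>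

lemma (in prob_space) indep_vars_reindex_inj:
  assumes "indep_vars M' X J" and inj: "inj_on f I" and sub: "f ` I \<subseteq> J"
  shows "indep_vars (\<lambda>i. M' (f i)) (\<lambda>i. X (f i)) I"
  unfolding indep_vars_def2
proof (intro conjI ballI)
  have rv: "random_variable (M' j) (X j)" if "j \<in> J" for j
    using assms(1) that by (simp add: indep_vars_def2)
  have ind: "indep_sets (\<lambda>j. {X j -` A \<inter> space M |A. A \<in> sets (M' j)}) J"
    using assms(1) by (simp add: indep_vars_def2)
  show "random_variable (M' (f i)) (X (f i))" if "i \<in> I" for i
    using rv that sub by blast
  show "indep_sets (\<lambda>i. {X (f i) -` A \<inter> space M |A. A \<in> sets (M' (f i))}) I"
  proof (rule indep_setsI)
    show "{X (f i) -` A \<inter> space M |A. A \<in> sets (M' (f i))} \<subseteq> events" if "i \<in> I" for i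
    proof -
      have "f i \<in> J" using that sub by blast
      then show ?thesis using rv measurable_sets by blast
    qed
    fix A L assume L: "L \<noteq> {}" "L \<subseteq> I" "finite L"
      and A: "\<forall>j\<in>L. A j \<in> {X (f j) -` A \<inter> space M |A. A \<in> sets (M' (f j))}"
    have inj': "inj_on f L" by (rule inj_on_subset[OF inj L(2)])
    define A' where "A' j = A (the_inv_into L f j)" for j
    have A': "A' (f j) = A j" if "j \<in> L" for j
      unfolding A'_def by (simp only: the_inv_into_f_f[OF inj' that])
    have "prob (\<Inter>j\<in>f ` L. A' j) = (\<Prod>j\<in>f ` L. prob (A' j))"
    proof (rule indep_setsD[OF ind])
      show "f ` L \<subseteq> J" using L(2) sub by blast
      show "\<forall>j\<in>f ` L. A' j \<in> {X j -` A \<inter> space M |A. A \<in> sets (M' j)}"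
      proof
        fix j assume "j \<in> f ` L"
        then obtain i where i: "i \<in> L" "j = f i" by blast
        show "A' j \<in> {X j -` A \<inter> space M |A. A \<in> sets (M' j)}"
          using bspec[OF A i(1)] unfolding i(2) A'[OF i(1)] .
      qed
    qed (use L in auto)
    moreover have "(\<Inter>j\<in>f ` L. A' j) = (\<Inter>j\<in>L. A j)" using A' by simp
    moreover have "(\<Prod>j\<in>f ` L. prob (A' j)) = (\<Prod>j\<in>L. prob (A j))"
      unfolding prod.reindex[OF inj'] o_def using A' by (intro prod.cong) auto
    ultimately show "prob (\<Inter>j\<in>L. A j) = (\<Prod>j\<in>L. prob (A j))" by simp
  qed
qed

text \<open>By independence both joint laws are product measures, and by identical distribution the
  factors agree. The two sequences thus have the same law, so \<open>f\<close> has the same mean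
  under both.\<close>

lemma (in prob_space) iid_exchangeable:
  fixes Z :: "nat \<Rightarrow> 'a \<Rightarrow> real" and f :: "(nat \<Rightarrow> real) \<Rightarrow> real"
  assumes ind: "indep_vars (\<lambda>_. borel) Z UNIV"
    and ident: "\<And>s. distr M borel (Z s) = distr M borel (Z 0)"
    and \<pi>: "inj \<pi>" and f: "f \<in> borel_measurable (PiM UNIV (\<lambda>_. borel))"
  shows "expectation (\<lambda>\<omega>. f (\<lambda>i. Z (\<pi> i) \<omega>)) = expectation (\<lambda>\<omega>. f (\<lambda>i. Z i \<omega>))"
proof -
  have rv: "random_variable borel (Z i)" for i
    using ind by (auto simp: indep_vars_def)
  have ind': "indep_vars (\<lambda>_. borel) (\<lambda>i. Z (\<pi> i)) UNIV"
    using indep_vars_reindex_inj[OF ind \<pi>] by simp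
  have "distr M (PiM UNIV (\<lambda>_. borel)) (\<lambda>\<omega> i. Z (\<pi> i) \<omega>) = PiM UNIV (\<lambda>i. distr M borel (Z (\<pi> i)))"
    using indep_vars_iff_distr_eq_PiM[where I=UNIV and M'="\<lambda>_. borel" and X="\<lambda>i. Z (\<pi> i)"] ind' rv
    by (simp add: restrict_UNIV)
  also have "\<dots> = PiM UNIV (\<lambda>i. distr M borel (Z i))"
    by (intro PiM_cong refl trans[OF ident ident[symmetric]])
  also have "\<dots> = distr M (PiM UNIV (\<lambda>_. borel)) (\<lambda>\<omega> i. Z i \<omega>)"
    using indep_vars_iff_distr_eq_PiM[where I=UNIV and M'="\<lambda>_. borel" and X=Z] ind rv
    by (simp add: restrict_UNIV)
  finally have eq: "distr M (PiM UNIV (\<lambda>_. borel)) (\<lambda>\<omega> i. Z (\<pi> i) \<omega>)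
    = distr M (PiM UNIV (\<lambda>_. borel)) (\<lambda>\<omega> i. Z i \<omega>)" .
  have m: "(\<lambda>\<omega> i. Z (\<pi> i) \<omega>) \<in> measurable M (PiM UNIV (\<lambda>_. borel))"
    "(\<lambda>\<omega> i. Z i \<omega>) \<in> measurable M (PiM UNIV (\<lambda>_. borel))"
    by (rule measurable_PiM_single'; simp add: rv)+
  show ?thesis
    using arg_cong[OF eq, of "\<lambda>D. integral\<^sup>L D f"]
    by (simp only: integral_distr[OF m(1) f] integral_distr[OF m(2) f])
qed

text \<open>The empirical means form a reverse martingale. The event is split according to the last time
 \<open>s\<close> at which the mean is below \<open>-\<delta>\<close>; that event \<open>A s\<close> depends symmetrically on \<open>Z 0, \<dots>, Z (s - 1)\<close>,
 so by exchangeability and convexity the mean may be replaced by \<open>Z 0\<close> in the exponential moment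
 on \<open>A s\<close>.\<close>
lemma (in prob_space) subgaussian_mean_maximal_ineq:
  fixes Z :: "nat \<Rightarrow> 'a \<Rightarrow> real"
  assumes ind: "indep_vars (\<lambda>_. borel) Z UNIV"
    and ident: "\<And>s. distr M borel (Z s) = distr M borel (Z 0)"
    and sub: "\<And>s. subgaussian M 1 (Z s)" and \<delta>: "0 \<le> \<delta>"
  shows "prob {\<omega> \<in> space M. \<exists>s\<in>{1..N}. (\<Sum>u<s. Z u \<omega>) < - \<delta> * real s} \<le> exp (- \<delta>\<^sup>2 / 2)"
proof -
  have rv[measurable]: "random_variable borel (Z i)" for i
    using ind by (auto simp: indep_vars_def)
  define A where "A s = {z :: nat \<Rightarrow> real. (\<Sum>u<s. z u) < - \<delta> * real s \<and>
    (\<forall>r\<in>{s<..N}. - \<delta> * real r \<le> (\<Sum>u<r. z u))}" for s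
  define E where "E s = {\<omega> \<in> space M. (\<lambda>i. Z i \<omega>) \<in> A s}" for s
  have E_meas[measurable]: "E s \<in> events" for s
    unfolding E_def A_def mem_Collect_eq by measurable
  have int: "integrable M (\<lambda>\<omega>. exp (- \<delta> * Z u \<omega>))" for u
    using sub[of u] unfolding subgaussian_def by blast
  have intI: "integrable M (\<lambda>\<omega>. indicator (E s) \<omega> * exp (- \<delta> * Z u \<omega>))" for s u
    using integrable_mult_indicator[OF E_meas int] by simp
  have swap: "expectation (\<lambda>\<omega>. indicator (E s) \<omega> * exp (- \<delta> * Z u \<omega>))
      = expectation (\<lambda>\<omega>. indicator (E s) \<omega> * exp (- \<delta> * Z 0 \<omega>))" if "u < s" for s u
  proof -
    define \<pi> where "\<pi> = Transposition.transpose 0 u"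
    define f where "f z = indicator (A s) z * exp (- \<delta> * z 0)" for z :: "nat \<Rightarrow> real"
    have [measurable]: "A s \<in> sets (PiM UNIV (\<lambda>_. borel))"
    proof -
      have "{z \<in> space (PiM UNIV (\<lambda>_. borel)). (\<Sum>u<s. z u) < - \<delta> * real s \<and>
        (\<forall>r\<in>{s<..N}. - \<delta> * real r \<le> (\<Sum>u<r. z u))} \<in> sets (PiM (UNIV :: nat set) (\<lambda>_. borel :: real measure))"
        by measurable
      then show ?thesis by (simp add: A_def space_PiM)
    qed
    have f: "f \<in> borel_measurable (PiM UNIV (\<lambda>_. borel))"
      unfolding f_def by measurable
    \<comment> \<open>The transposition moves only indices below \<open>s\<close>, so it can change
      only the partial sums shorter than \<open>s\<close>. This is why \<open>A s\<close> marks the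
      last crossing: it constrains no length below \<open>s\<close>, whereas a first crossing
      would.\<close>
    have perm: "(\<Sum>v<r. z (\<pi> v)) = (\<Sum>v<r. z v)" if "s \<le> r" for r and z :: "nat \<Rightarrow> real"
    proof -
      have "\<pi> permutes {..<r}"
        unfolding \<pi>_def using that \<open>u < s\<close> by (intro permutes_swap_id) auto
      from sum.permute[OF this, of z] show ?thesis by (simp only: o_def)
    qed
    have A: "(\<lambda>i. z (\<pi> i)) \<in> A s \<longleftrightarrow> z \<in> A s" for z
    proof -
      have "(\<forall>r\<in>{s<..N}. - \<delta> * real r \<le> (\<Sum>v<r. z (\<pi> v))) \<longleftrightarrow> (\<forall>r\<in>{s<..N}. - \<delta> * real r \<le> (\<Sum>v<r. z v))"
        by (intro ball_cong refl) (simp only: perm greaterThanAtMost_iff less_imp_le)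
      then show ?thesis unfolding A_def mem_Collect_eq by (simp only: perm order_refl)
    qed
    have "inj \<pi>" by (simp add: \<pi>_def)
    have "expectation (\<lambda>\<omega>. f (\<lambda>i. Z (\<pi> i) \<omega>)) = expectation (\<lambda>\<omega>. f (\<lambda>i. Z i \<omega>))"
      by (rule iid_exchangeable[OF ind ident \<open>inj \<pi>\<close> f])
    moreover have "expectation (\<lambda>\<omega>. f (\<lambda>i. Z (\<pi> i) \<omega>)) = expectation (\<lambda>\<omega>. indicator (E s) \<omega> * exp (- \<delta> * Z u \<omega>))"
    proof (intro Bochner_Integration.integral_cong refl)
      fix \<omega> assume "\<omega> \<in> space M"
      then have "indicator (A s) (\<lambda>i. Z (\<pi> i) \<omega>) = (indicator (E s) \<omega> :: real)"
        using A[of "\<lambda>i. Z i \<omega>"] by (simp only: indicator_def E_def mem_Collect_eq simp_thms)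
      moreover have "\<pi> 0 = u" by (simp add: \<pi>_def)
      ultimately show "f (\<lambda>i. Z (\<pi> i) \<omega>) = indicator (E s) \<omega> * exp (- \<delta> * Z u \<omega>)"
        by (simp only: f_def)
    qed
    moreover have "expectation (\<lambda>\<omega>. f (\<lambda>i. Z i \<omega>)) = expectation (\<lambda>\<omega>. indicator (E s) \<omega> * exp (- \<delta> * Z 0 \<omega>))"
      by (intro Bochner_Integration.integral_cong refl) (auto simp: f_def E_def indicator_def)
    ultimately show ?thesis by simp
  qed
  have E_bound: "exp (\<delta>\<^sup>2) * prob (E s) \<le> expectation (\<lambda>\<omega>. indicator (E s) \<omega> * exp (- \<delta> * Z 0 \<omega>))"
    if s: "1 \<le> s" for s
  proof -
    have "exp (\<delta>\<^sup>2) * prob (E s) = expectation (\<lambda>\<omega>. exp (\<delta>\<^sup>2) * indicator (E s) \<omega>)"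
      using E_meas by simp
    also have "\<dots> \<le> expectation (\<lambda>\<omega>. \<Sum>u<s. (1 / real s) * (indicator (E s) \<omega> * exp (- \<delta> * Z u \<omega>)))"
    proof (rule integral_mono)
      show "integrable M (\<lambda>\<omega>. exp (\<delta>\<^sup>2) * indicator (E s) \<omega>)"
        using E_meas by (intro integrable_mult_right integrable_real_indicator) (auto simp: emeasure_eq_measure)
      show "integrable M (\<lambda>\<omega>. \<Sum>u<s. (1 / real s) * (indicator (E s) \<omega> * exp (- \<delta> * Z u \<omega>)))"
        by (intro Bochner_Integration.integrable_sum integrable_mult_right intI)
      fix \<omega> assume "\<omega> \<in> space M"
      show "exp (\<delta>\<^sup>2) * indicator (E s) \<omega> \<le> (\<Sum>u<s. (1 / real s) * (indicator (E s) \<omega> * exp (- \<delta> * Z u \<omega>)))"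
      proof (cases "\<omega> \<in> E s")
        case True
        then have "(\<Sum>u<s. Z u \<omega>) \<le> - \<delta> * real s" by (simp add: E_def A_def)
        then have "\<delta> * (\<Sum>u<s. Z u \<omega>) \<le> \<delta> * (- \<delta> * real s)" using \<delta> by (intro mult_left_mono) auto
        then have "\<delta>\<^sup>2 * real s \<le> - (\<delta> * (\<Sum>u<s. Z u \<omega>))"
          by (simp add: power2_eq_square)
        then have "\<delta>\<^sup>2 \<le> - (\<delta> * (\<Sum>u<s. Z u \<omega>)) / real s"
          using s by (subst pos_le_divide_eq) auto
        also have "\<dots> = (1 / real s) * (\<Sum>u<s. - \<delta> * Z u \<omega>)"
          unfolding sum_distrib_left[symmetric] by simp
        also have "\<dots> = (\<Sum>u<s. (1 / real s) *\<^sub>R (- \<delta> * Z u \<omega>))"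
          unfolding sum_distrib_left real_scaleR_def ..
        finally have "\<delta>\<^sup>2 \<le> (\<Sum>u<s. (1 / real s) *\<^sub>R (- \<delta> * Z u \<omega>))" .
        then have "exp (\<delta>\<^sup>2) \<le> exp (\<Sum>u<s. (1 / real s) *\<^sub>R (- \<delta> * Z u \<omega>))" by simp
        \<comment> \<open>Jensen's inequality for \<open>exp\<close> with the uniform weights
          \<open>1 / s\<close>.\<close>
        also have "\<dots> \<le> (\<Sum>u<s. (1 / real s) * exp (- \<delta> * Z u \<omega>))"
          using s by (intro convex_on_sum[OF _ _ exp_convex]) (auto simp: lessThan_empty_iff)
        finally show ?thesis using True by simp
      qed simp
    qed
    also have "\<dots> = (\<Sum>u<s. (1 / real s) * expectation (\<lambda>\<omega>. indicator (E s) \<omega> * exp (- \<delta> * Z u \<omega>)))"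
      by (subst Bochner_Integration.integral_sum)
        (intro integrable_mult_right intI, simp only: integral_mult_right_zero)
    also have "\<dots> = (\<Sum>u<s. (1 / real s) * expectation (\<lambda>\<omega>. indicator (E s) \<omega> * exp (- \<delta> * Z 0 \<omega>)))"
      by (intro sum.cong refl arg_cong[where f="(*) (1 / real s)"] swap) simp
    also have "\<dots> = expectation (\<lambda>\<omega>. indicator (E s) \<omega> * exp (- \<delta> * Z 0 \<omega>))"
      using s by simp
    finally show ?thesis .
  qed
  have disj_less: "E a \<inter> E b = {}" if "a < b" "b \<le> N" for a b
  proof -
    have b: "b \<in> {a<..N}" using that by simp
    have "\<omega> \<notin> E b" if "\<omega> \<in> E a" for \<omega>
    proof -
      have "\<forall>r\<in>{a<..N}. - \<delta> * real r \<le> (\<Sum>u<r. Z u \<omega>)"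
        using that unfolding E_def A_def mem_Collect_eq by (elim conjE)
      from bspec[OF this b] have "\<not> (\<Sum>u<b. Z u \<omega>) < - \<delta> * real b" by simp
      then show ?thesis by (simp only: E_def A_def mem_Collect_eq simp_thms)
    qed
    then show ?thesis by blast
  qed
  have disj: "disjoint_family_on E {1..N}"
    unfolding disjoint_family_on_def
  proof (intro ballI impI)
    fix a b assume "a \<in> {1..N}" "b \<in> {1..N}" "a \<noteq> b"
    then show "E a \<inter> E b = {}"
      using disj_less[of a b] disj_less[of b a] by (cases "a < b") (simp_all add: Int_commute)
  qed
  have "{\<omega> \<in> space M. \<exists>s\<in>{1..N}. (\<Sum>u<s. Z u \<omega>) < - \<delta> * real s} \<subseteq> (\<Union>s\<in>{1..N}. E s)"
  proof
    fix \<omega> assume \<omega>: "\<omega> \<in> {\<omega> \<in> space M. \<exists>s\<in>{1..N}. (\<Sum>u<s. Z u \<omega>) < - \<delta> * real s}"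
    define Q where "Q = {s\<in>{1..N}. (\<Sum>u<s. Z u \<omega>) < - \<delta> * real s}"
    have Q: "finite Q" "Q \<noteq> {}" using \<omega> by (auto simp: Q_def)
    then have MQ: "Max Q \<in> Q" by (rule Max_in)
    have later: "- \<delta> * real r \<le> (\<Sum>u<r. Z u \<omega>)" if r: "r \<in> {Max Q<..N}" for r
    proof (rule ccontr)
      assume "\<not> - \<delta> * real r \<le> (\<Sum>u<r. Z u \<omega>)"
      with r have "r \<in> Q" by (simp add: Q_def)
      from Max_ge[OF Q(1) this] r show False by simp
    qed
    have "\<omega> \<in> E (Max Q)"
      unfolding E_def A_def mem_Collect_eq
    proof (intro conjI ballI later)
      show "\<omega> \<in> space M" using \<omega> by simp
      show "(\<Sum>u<Max Q. Z u \<omega>) < - \<delta> * real (Max Q)" using MQ unfolding Q_def by blast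
    qed
    moreover have "Max Q \<in> {1..N}" using MQ unfolding Q_def by blast
    ultimately show "\<omega> \<in> (\<Union>s\<in>{1..N}. E s)" by blast
  qed
  then have "prob {\<omega> \<in> space M. \<exists>s\<in>{1..N}. (\<Sum>u<s. Z u \<omega>) < - \<delta> * real s} \<le> prob (\<Union>s\<in>{1..N}. E s)"
    by (intro finite_measure_mono) auto
  also have "\<dots> = (\<Sum>s\<in>{1..N}. prob (E s))"
    using disj by (intro finite_measure_finite_Union) auto
  finally have "exp (\<delta>\<^sup>2) * prob {\<omega> \<in> space M. \<exists>s\<in>{1..N}. (\<Sum>u<s. Z u \<omega>) < - \<delta> * real s}
      \<le> (\<Sum>s\<in>{1..N}. exp (\<delta>\<^sup>2) * prob (E s))"
    unfolding sum_distrib_left[symmetric] by (simp only: mult_le_cancel_left_pos[OF exp_gt_zero])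
  also have "\<dots> \<le> (\<Sum>s\<in>{1..N}. expectation (\<lambda>\<omega>. indicator (E s) \<omega> * exp (- \<delta> * Z 0 \<omega>)))"
    using E_bound by (intro sum_mono) auto
  also have "\<dots> = expectation (\<lambda>\<omega>. \<Sum>s\<in>{1..N}. indicator (E s) \<omega> * exp (- \<delta> * Z 0 \<omega>))"
    by (rule Bochner_Integration.integral_sum[symmetric]) (rule intI)
  \<comment> \<open>After the exchange every term carries the same integrand, so the disjoint events
    merge into a single indicator, itself at most 1. No factor depending on \<open>N\<close> is
    lost.\<close>
  also have "\<dots> = expectation (\<lambda>\<omega>. indicator (\<Union>s\<in>{1..N}. E s) \<omega> * exp (- \<delta> * Z 0 \<omega>))"
    using disj by (simp add: indicator_UN_disjoint sum_distrib_right)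
  also have "\<dots> \<le> expectation (\<lambda>\<omega>. exp (- \<delta> * Z 0 \<omega>))"
  proof (rule integral_mono[OF _ int])
    show "integrable M (\<lambda>\<omega>. indicator (\<Union>s\<in>{1..N}. E s) \<omega> * exp (- \<delta> * Z 0 \<omega>))"
      using integrable_mult_indicator[OF _ int, of "\<Union>s\<in>{1..N}. E s" 0] by simp
  qed (auto simp: indicator_def)
  also have "\<dots> \<le> exp ((- \<delta>)\<^sup>2 * 1\<^sup>2 / 2)"
    using sub[of 0] unfolding subgaussian_def by blast
  \<comment> \<open>The exponential moment at \<open>- \<delta>\<close> costs
    \<open>\<delta>\<^sup>2 / 2\<close>, against the gain \<open>\<delta>\<^sup>2\<close> from the
    events.\<close>
  finally have "prob {\<omega> \<in> space M. \<exists>s\<in>{1..N}. (\<Sum>u<s. Z u \<omega>) < - \<delta> * real s}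
      \<le> exp ((- \<delta>)\<^sup>2 * 1\<^sup>2 / 2) / exp (\<delta>\<^sup>2)"
    by (simp add: field_simps)
  also have "\<dots> = exp (- \<delta>\<^sup>2 / 2)" by (simp add: exp_diff[symmetric])
  finally show ?thesis .
qed

text \<open>Chernoff's bound with the optimal exponent parameter \<open>d\<close>. The result is
  kept as an \<open>s\<close>-th power, so that summing over \<open>s\<close> gives a geometric
  series.\<close>

lemma (in prob_space) subgaussian_sum_tail:
  fixes Z :: "nat \<Rightarrow> 'a \<Rightarrow> real"
  assumes ind: "indep_vars (\<lambda>_. borel) Z UNIV"
    and sub: "\<And>s. subgaussian M 1 (Z s)" and d: "0 < d"
  shows "prob {\<omega> \<in> space M. d * real s \<le> (\<Sum>u<s. Z u \<omega>)} \<le> exp (- d\<^sup>2 / 2) ^ s"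
proof -
  have int: "integrable M (\<lambda>\<omega>. exp (d * Z u \<omega>))"
    and le: "expectation (\<lambda>\<omega>. exp (d * Z u \<omega>)) \<le> exp (d\<^sup>2 / 2)" for u
    using sub[of u] by (auto simp: subgaussian_def)
  have ind': "indep_vars (\<lambda>_. borel) (\<lambda>u \<omega>. exp (d * Z u \<omega>)) {..<s}"
    by (rule indep_vars_compose2[OF indep_vars_subset[OF ind]]) auto
  have eq: "exp (d * (\<Sum>u<s. Z u \<omega>)) = (\<Prod>u<s. exp (d * Z u \<omega>))" for \<omega>
    by (simp add: sum_distrib_left exp_sum)
  have I: "integrable M (\<lambda>\<omega>. exp (d * (\<Sum>u<s. Z u \<omega>)))"
    unfolding eq by (rule indep_vars_integrable[OF _ ind' int]) simp
  have "prob {\<omega> \<in> space M. d * real s \<le> (\<Sum>u<s. Z u \<omega>)}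
      \<le> exp (- d * (d * real s)) * (LINT \<omega>:space M|M. exp (d * (\<Sum>u<s. Z u \<omega>)))"
    by (rule Chernoff_ineq_ge[OF d]) (use integrable_mult_indicator[OF sets.top I] in \<open>simp_all add: set_integrable_def\<close>)
  also have "(LINT \<omega>:space M|M. exp (d * (\<Sum>u<s. Z u \<omega>))) = expectation (\<lambda>\<omega>. exp (d * (\<Sum>u<s. Z u \<omega>)))"
    by (rule set_integral_space[OF I])
  also have "\<dots> = (\<Prod>u<s. expectation (\<lambda>\<omega>. exp (d * Z u \<omega>)))"
    unfolding eq by (rule indep_vars_lebesgue_integral[OF _ ind' int]) simp
  also have "\<dots> \<le> (\<Prod>u<s. exp (d\<^sup>2 / 2))"
    using le by (intro prod_mono) (auto intro: integral_nonneg_AE)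
  also have "exp (- d * (d * real s)) * \<dots> = exp (- d\<^sup>2 / 2) ^ s"
    by (simp add: exp_of_nat_mult[symmetric] exp_add[symmetric] power2_eq_square field_simps)
  finally show ?thesis by simp
qed

text \<open>Distinct rows are functions of the disjoint index blocks
  \<open>{i} \<times> UNIV\<close>, hence independent as random sequences. This turns the failure of
  all best arms into a product of failure probabilities of single arms.\<close>

lemma (in prob_space) indep_rows_prob_all:
  fixes X :: "'i \<Rightarrow> 'j \<Rightarrow> 'a \<Rightarrow> 'b"
  assumes ind: "indep_vars (\<lambda>_. N) (\<lambda>p. X (fst p) (snd p)) UNIV"
    and B: "finite B" and A: "A \<in> sets (PiM UNIV (\<lambda>_. N))"
  shows "prob {\<omega> \<in> space M. \<forall>i\<in>B. (\<lambda>s. X i s \<omega>) \<in> A}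
    = (\<Prod>i\<in>B. prob {\<omega> \<in> space M. (\<lambda>s. X i s \<omega>) \<in> A})"
proof (cases "B = {}")
  case False
  have "indep_vars (\<lambda>i. PiM ({i} \<times> UNIV) (\<lambda>_. N))
    (\<lambda>i \<omega>. restrict (\<lambda>p. X (fst p) (snd p) \<omega>) ({i} \<times> UNIV)) B"
    by (rule indep_vars_restrict[OF ind]) (auto simp: disjoint_family_on_def)
  then have "indep_vars (\<lambda>_. PiM UNIV (\<lambda>_. N))
    (\<lambda>i \<omega>. (\<lambda>f s. f (i, s)) (restrict (\<lambda>p. X (fst p) (snd p) \<omega>) ({i} \<times> UNIV))) B"
    by (rule indep_vars_compose2) (intro measurable_PiM_single' measurable_component_singleton; auto simp: space_PiM PiE_def)
  then have "indep_vars (\<lambda>_. PiM UNIV (\<lambda>_. N)) (\<lambda>i \<omega> s. X i s \<omega>) B"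
    by simp
  from indep_varsD_finite[OF this False B, of "\<lambda>_. A"] A
  have "prob (\<Inter>i\<in>B. (\<lambda>\<omega> s. X i s \<omega>) -` A \<inter> space M)
      = (\<Prod>i\<in>B. prob ((\<lambda>\<omega> s. X i s \<omega>) -` A \<inter> space M))" by simp
  moreover have "(\<Inter>i\<in>B. (\<lambda>\<omega> s. X i s \<omega>) -` A \<inter> space M) = {\<omega> \<in> space M. \<forall>i\<in>B. (\<lambda>s. X i s \<omega>) \<in> A}"
    using False by auto
  moreover have "(\<lambda>\<omega> s. X i s \<omega>) -` A \<inter> space M = {\<omega> \<in> space M. (\<lambda>s. X i s \<omega>) \<in> A}" for i
    by auto
  ultimately show ?thesis by simp
qed (simp add: prob_space)

section \<open>The greedy rule\<close>

lemma pulls_append [simp]: "pulls (h @ [a]) i = pulls h i + (if a = i then 1 else 0)"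
  by (simp add: pulls_def)

lemma pulls_le_length: "pulls h i \<le> length h"
  by (simp add: pulls_def)

lemma length_greedy_hist [simp]: "length (greedy_hist tb S X t) = t"
  by (induction t) (simp_all add: Let_def)

lemma tb_greedy_maximizers:
  assumes "valid_tiebreak tb" "finite S" "S \<noteq> {}"
  shows "tb h (greedy_maximizers S X h) \<in> greedy_maximizers S X h"
proof -
  have "Max (emp_mean X h ` S) \<in> emp_mean X h ` S"
    using assms by (intro Max_in) auto
  then obtain i where i: "i \<in> S" "emp_mean X h i = Max (emp_mean X h ` S)" by force
  with assms(2) have "i \<in> greedy_maximizers S X h"
    by (auto simp: greedy_maximizers_def intro: Max_ge)
  moreover have "finite (greedy_maximizers S X h)"
    using assms(2) by (simp add: greedy_maximizers_def)
  ultimately show ?thesis using assms(1) unfolding valid_tiebreak_def by blast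
qed

lemma set_greedy_hist:
  assumes "valid_tiebreak tb" "finite S" "S \<noteq> {}"
  shows "set (greedy_hist tb S X t) \<subseteq> S"
  using tb_greedy_maximizers[OF assms]
  by (induction t) (auto simp: Let_def greedy_maximizers_def)

text \<open>Regrouping the rounds by the arm pulled passes from costs per round to pull
  counts.\<close>

lemma sum_nth_eq_sum_pulls:
  fixes f :: "nat \<Rightarrow> real"
  assumes "finite S" "set h \<subseteq> S"
  shows "(\<Sum>t<length h. f (h ! t)) = (\<Sum>i\<in>S. f i * real (pulls h i))"
  using assms(2)
proof (induction h rule: rev_induct)
  case (snoc a h)
  have "(\<Sum>t<length (h @ [a]). f ((h @ [a]) ! t)) = (\<Sum>t<length h. f (h ! t)) + f a"
    by (simp add: nth_append)
  moreover have "(\<Sum>i\<in>S. f i * real (pulls (h @ [a]) i))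
      = (\<Sum>i\<in>S. f i * real (pulls h i)) + (\<Sum>i\<in>S. if a = i then f i else 0)"
    unfolding sum.distrib[symmetric] by (intro sum.cong) (auto simp: algebra_simps)
  ultimately show ?case using snoc assms(1) by simp
qed (simp add: pulls_def)

section \<open>Counting the pulls of a suboptimal arm\<close>

text \<open>Consider the round in which \<open>i\<close> is pulled for the \<open>(s+1)\<close>-th
  time. The empirical mean of \<open>i\<close>, over exactly \<open>s\<close> rewards, is then
  maximal, so it dominates that of \<open>k\<close>, which \<open>good\<close> keeps above
  \<open>c\<close> at every count up to \<open>T\<close>.\<close>

lemma greedy_repull_mean:
  assumes tb: "valid_tiebreak tb" and S: "finite S" and k: "k \<in> S"
    and good: "\<forall>s\<in>{1..T}. c * real s \<le> (\<Sum>u<s. X k u)"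
    and "t \<le> T" "1 \<le> s" "s < pulls (greedy_hist tb S X t) i"
  shows "c * real s \<le> (\<Sum>u<s. X i u)"
  using assms(5-)
proof (induction t)
  case (Suc t)
  define h where "h = greedy_hist tb S X t"
  define a where "a = tb h (greedy_maximizers S X h)"
  have hist: "greedy_hist tb S X (Suc t) = h @ [a]" by (simp add: h_def a_def Let_def)
  show ?case
  proof (cases "s < pulls h i")
    case True
    then show ?thesis using Suc by (simp add: h_def)
  next
    case False
    with Suc.prems hist have ai: "a = i" and s: "s = pulls h i"
      by (auto split: if_splits)
    have "a \<in> greedy_maximizers S X h"
      unfolding a_def using k by (intro tb_greedy_maximizers tb S) auto
    then have le: "emp_mean X h k \<le> emp_mean X h i" using k ai by (auto simp: greedy_maximizers_def)
    \<comment> \<open>An unpulled \<open>k\<close> would have empirical mean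
      \<open>\<infinity>\<close>, while that of \<open>i\<close> is finite because
      \<open>1 \<le> s\<close>. So \<open>good\<close> applies to the current count of
      \<open>k\<close>.\<close>
    then have pk: "pulls h k \<noteq> 0" using s Suc.prems(2)
      by (cases "pulls h k = 0") (auto simp: emp_mean_def)
    have "pulls h k \<le> T" using pulls_le_length[of h k] Suc.prems(1) by (simp add: h_def)
    with good pk have "c * real (pulls h k) \<le> (\<Sum>u<pulls h k. X k u)" by auto
    then have "c \<le> (\<Sum>u<pulls h k. X k u) / real (pulls h k)"
      using pk by (simp add: field_simps)
    also have "\<dots> \<le> (\<Sum>u<s. X i u) / real s"
      using le pk s Suc.prems(2) by (simp add: emp_mean_def)
    finally show ?thesis using Suc.prems(2) by (simp add: field_simps)
  qed
qed (simp add: pulls_def)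

text \<open>The first pull is free, and every later one is charged to the number \<open>s\<close> of
  earlier pulls of \<open>i\<close>, a value at which the mean of \<open>i\<close> reached
  \<open>c\<close>. The resulting count depends on the rewards of \<open>i\<close> only and no
  longer on the history.\<close>

lemma greedy_pulls_le:
  assumes tb: "valid_tiebreak tb" and S: "finite S" and k: "k \<in> S"
    and good: "\<forall>s\<in>{1..T}. c * real s \<le> (\<Sum>u<s. X k u)"
  shows "real (pulls (greedy_hist tb S X T) i)
    \<le> 1 + (\<Sum>s\<in>{1..T}. if c * real s \<le> (\<Sum>u<s. X i u) then 1 else 0)"
proof -
  let ?p = "pulls (greedy_hist tb S X T) i"
  have "?p \<le> T" using pulls_le_length[of "greedy_hist tb S X T" i] by simp
  then have "{1..<?p} \<subseteq> {s\<in>{1..T}. c * real s \<le> (\<Sum>u<s. X i u)}"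
    using greedy_repull_mean[where X=X and c=c and T=T, OF tb S k good order_refl] by auto
  then have "card {1..<?p} \<le> card {s\<in>{1..T}. c * real s \<le> (\<Sum>u<s. X i u)}"
    by (intro card_mono) auto
  then have "real ?p \<le> 1 + real (card {s\<in>{1..T}. c * real s \<le> (\<Sum>u<s. X i u)})" by simp
  also have "real (card {s\<in>{1..T}. c * real s \<le> (\<Sum>u<s. X i u)})
      = (\<Sum>s\<in>{1..T}. if c * real s \<le> (\<Sum>u<s. X i u) then 1 else 0)"
    by (subst sum.inter_filter[symmetric]) simp_all
  finally show ?thesis .
qed

text \<open>The regret bound for one realisation of the rewards. If no arm of \<open>B\<close> stays
  above \<open>c\<close>, each round costs at most 1; otherwise arms of gap at most \<open>d\<close>
  cost at most \<open>d\<close> per round, and the others are counted by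
  \<open>greedy_pulls_le\<close>.\<close>

lemma greedy_gap_sum_le:
  assumes tb: "valid_tiebreak tb" and S: "finite S" "S \<noteq> {}" and B: "B \<subseteq> S"
    and \<Delta>: "\<And>i. i \<in> S \<Longrightarrow> 0 \<le> \<Delta> i \<and> \<Delta> i \<le> 1" and d: "0 \<le> d"
  shows "(\<Sum>t<T. \<Delta> (greedy_hist tb S X T ! t)) \<le>
    real T * (if \<exists>k\<in>B. \<forall>s\<in>{1..T}. c * real s \<le> (\<Sum>u<s. X k u) then 0 else 1) + d * real T
    + (\<Sum>i\<in>{i\<in>S. d < \<Delta> i}. \<Delta> i * (1 + (\<Sum>s\<in>{1..T}. if c * real s \<le> (\<Sum>u<s. X i u) then 1 else 0)))"
proof -
  define h where "h = greedy_hist tb S X T"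
  define P where "P i = (\<Sum>s\<in>{1..T}. if c * real s \<le> (\<Sum>u<s. X i u) then 1 else 0 :: real)" for i
  have P0: "0 \<le> P i" for i unfolding P_def by (intro sum_nonneg) auto
  have hS: "set h \<subseteq> S" unfolding h_def by (rule set_greedy_hist[OF tb S])
  have len: "length h = T" by (simp add: h_def)
  have nth: "h ! t \<in> S" if "t < T" for t using hS len that by (metis nth_mem subsetD)
  have rest: "0 \<le> (\<Sum>i\<in>{i\<in>S. d < \<Delta> i}. \<Delta> i * (1 + P i))"
    using \<Delta> P0 by (intro sum_nonneg mult_nonneg_nonneg add_nonneg_nonneg) auto
  have "(\<Sum>t<T. \<Delta> (h ! t)) \<le>
    real T * (if \<exists>k\<in>B. \<forall>s\<in>{1..T}. c * real s \<le> (\<Sum>u<s. X k u) then 0 else 1) + d * real T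
    + (\<Sum>i\<in>{i\<in>S. d < \<Delta> i}. \<Delta> i * (1 + P i))"
  proof (cases "\<exists>k\<in>B. \<forall>s\<in>{1..T}. c * real s \<le> (\<Sum>u<s. X k u)")
    case True
    then obtain k where k: "k \<in> S" "\<forall>s\<in>{1..T}. c * real s \<le> (\<Sum>u<s. X k u)" using B by blast
    \<comment> \<open>Every round is charged \<open>d\<close>, and the full gap on top of it if the
      gap exceeds \<open>d\<close>.\<close>
    have "(\<Sum>t<T. \<Delta> (h ! t)) \<le> (\<Sum>t<T. d + (if d < \<Delta> (h ! t) then \<Delta> (h ! t) else 0))"
      using d by (intro sum_mono) auto
    also have "\<dots> = d * real T + (\<Sum>t<length h. (\<lambda>i. if d < \<Delta> i then \<Delta> i else 0) (h ! t))"
      by (simp add: sum.distrib len)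
    also have "(\<Sum>t<length h. (\<lambda>i. if d < \<Delta> i then \<Delta> i else 0) (h ! t))
        = (\<Sum>i\<in>S. (if d < \<Delta> i then \<Delta> i else 0) * real (pulls h i))"
      by (rule sum_nth_eq_sum_pulls[OF S(1) hS])
    also have "\<dots> = (\<Sum>i\<in>{i\<in>S. d < \<Delta> i}. \<Delta> i * real (pulls h i))"
      by (subst sum.inter_filter[OF S(1)]) (auto intro!: sum.cong)
    also have "\<dots> \<le> (\<Sum>i\<in>{i\<in>S. d < \<Delta> i}. \<Delta> i * (1 + P i))"
      unfolding h_def P_def using \<Delta> by (intro sum_mono mult_left_mono greedy_pulls_le[where X=X and c=c and T=T, OF tb S(1) k]) auto
    finally show ?thesis using True by simp
  next
    case False
    have "(\<Sum>t<T. \<Delta> (h ! t)) \<le> (\<Sum>t<T. 1)" using \<Delta> nth by (intro sum_mono) auto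
    moreover have "0 \<le> d * real T" using d by simp
    ultimately show ?thesis using rest unfolding if_not_P[OF False] by simp
  qed
  then show ?thesis unfolding h_def P_def .
qed

section \<open>Measurability of the history and a geometric series\<close>

text \<open>Histories form a countable type, so it suffices to treat one step from a fixed
  \<open>h\<close>. There the set of maximizers takes finitely many values, each determined by
  finitely many comparisons of empirical means.\<close>

lemma measurable_greedy_hist:
  assumes [measurable]: "\<And>i s. X i s \<in> borel_measurable M" and S: "finite S"
  shows "(\<lambda>\<omega>. greedy_hist tb S (\<lambda>i s. X i s \<omega>) t) \<in> measurable M (count_space UNIV)"
proof (induction t)
  case (Suc t)
  have "(\<lambda>\<omega>. h @ [tb h (greedy_maximizers S (\<lambda>i s. X i s \<omega>) h)]) \<in> measurable M (count_space UNIV)" for h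
  proof -
    have [measurable]: "(\<lambda>\<omega>. emp_mean (\<lambda>i s. X i s \<omega>) h i) \<in> borel_measurable M" for i
      unfolding emp_mean_def by (cases "pulls h i = 0") simp_all
    have "(\<lambda>\<omega>. greedy_maximizers S (\<lambda>i s. X i s \<omega>) h) \<in> measurable M (count_space (Pow S))"
      unfolding measurable_count_space_eq2[OF finite_Pow_iff[THEN iffD2, OF S]]
    proof (intro conjI ballI)
      show "(\<lambda>\<omega>. greedy_maximizers S (\<lambda>i s. X i s \<omega>) h) \<in> space M \<rightarrow> Pow S"
        by (auto simp: greedy_maximizers_def)
      fix A assume "A \<in> Pow S"
      then have "(\<lambda>\<omega>. greedy_maximizers S (\<lambda>i s. X i s \<omega>) h) -` {A} \<inter> space M
        = {\<omega> \<in> space M. \<forall>i\<in>S. i \<in> A \<longleftrightarrow> (\<forall>j\<in>S. emp_mean (\<lambda>i s. X i s \<omega>) h j \<le> emp_mean (\<lambda>i s. X i s \<omega>) h i)}"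
        by (auto simp: greedy_maximizers_def)
      also have "\<dots> \<in> sets M" using countable_finite[OF S] by measurable
      finally show "(\<lambda>\<omega>. greedy_maximizers S (\<lambda>i s. X i s \<omega>) h) -` {A} \<inter> space M \<in> sets M" .
    qed
    then show ?thesis
      by (rule measurable_compose[where g="\<lambda>A. h @ [tb h A]"]) simp
  qed
  from measurable_compose_countable[OF this Suc] show ?case by (simp add: Let_def)
qed simp

text \<open>The inequality \<open>x * exp (- x) \<le> 1 - exp (- x)\<close> bounds \<open>x\<close>
  times the \<open>s\<close>-th term by \<open>exp (- x) ^ (s - 1) - exp (- x) ^ s\<close>, and the
  sum telescopes.\<close>

lemma sum_exp_power_le:
  fixes x :: real
  assumes "0 < x"
  shows "(\<Sum>s\<in>{1..N}. exp (- x) ^ s) \<le> 1 / x"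
proof -
  have step: "x * exp (- x) \<le> 1 - exp (- x)"
  proof -
    have "(1 + x) * exp (- x) \<le> exp x * exp (- x)"
      by (intro mult_right_mono) auto
    also have "\<dots> = 1" by (simp add: exp_add[symmetric])
    finally show ?thesis by (simp add: algebra_simps)
  qed
  have "x * (\<Sum>s\<in>{1..N}. exp (- x) ^ s) \<le> 1 - exp (- x) ^ N"
  proof (induction N)
    case (Suc N)
    have "exp (- x) ^ N * (x * exp (- x)) \<le> exp (- x) ^ N * (1 - exp (- x))"
      by (intro mult_left_mono step) auto
    with Suc show ?case by (simp add: algebra_simps)
  qed simp
  also have "\<dots> \<le> 1" by simp
  finally show ?thesis using assms by (simp add: field_simps)
qed

section \<open>Regret\<close>

text \<open>Expectation of the bound per realisation for a fixed subsample. The failure term is a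
  power of one number with the count of best arms in \<open>S\<close> as exponent, the form that can
  be averaged over \<open>S\<close>. The crude bound by \<open>T\<close> serves short horizons and
  large \<open>\<gamma>\<close>.\<close>

lemma (in prob_space) greedy_regret_le:
  fixes eps :: "nat \<Rightarrow> nat \<Rightarrow> 'a \<Rightarrow> real" and \<mu> :: "nat \<Rightarrow> real"
  assumes ind: "indep_vars (\<lambda>_. borel) (\<lambda>p. eps (fst p) (snd p)) UNIV"
    and ident: "\<And>i s. distr M borel (eps i s) = distr M borel (eps 0 0)"
    and sub: "\<And>i s. subgaussian M 1 (eps i s)"
    and tb: "valid_tiebreak tb" and S: "finite S" "S \<noteq> {}"
    and \<mu>: "\<And>i. i \<in> S \<Longrightarrow> \<mu> i \<le> m \<and> m - \<mu> i \<le> 1" and \<delta>: "0 < \<delta>"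
  shows "real T * m - expectation (\<lambda>\<omega>. \<Sum>t<T. \<mu> (greedy_hist tb S (\<lambda>i s. \<mu> i + eps i s \<omega>) T ! t))
    \<le> real T * exp (- \<delta>\<^sup>2 / 2) ^ card {i\<in>S. \<mu> i = m} + 3 * \<delta> * real T
      + real (card S) * (1 + 3 / (2 * \<delta>))" (is "?R \<le> _")
    and "real T * m - expectation (\<lambda>\<omega>. \<Sum>t<T. \<mu> (greedy_hist tb S (\<lambda>i s. \<mu> i + eps i s \<omega>) T ! t))
    \<le> real T"
proof -
  have rv[measurable]: "random_variable borel (eps i s)" for i s
    using sub[of i s] by (simp add: subgaussian_def)
  have row: "indep_vars (\<lambda>_. borel) (eps i) UNIV" for i
    using indep_vars_reindex_inj[OF ind, of "\<lambda>s. (i, s)" UNIV] by (simp add: inj_def)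
  have row_ident: "distr M borel (eps i s) = distr M borel (eps i 0)" for i s
    by (rule trans[OF ident ident[symmetric]])
  define X where "X \<omega> = (\<lambda>i s. \<mu> i + eps i s \<omega>)" for \<omega>
  define h where "h \<omega> = greedy_hist tb S (X \<omega>) T" for \<omega>
  define \<Delta> where "\<Delta> i = m - \<mu> i" for i
  define B where "B = {i\<in>S. \<mu> i = m}"
  define L where "L = {i\<in>S. 3 * \<delta> < \<Delta> i}"
  \<comment> \<open>Every best arm has some empirical mean below \<open>m - \<delta>\<close>. If
    \<open>B\<close> is empty this is the whole space, matching the failure bound 1.\<close>
  define bad where "bad = {\<omega> \<in> space M. \<forall>k\<in>B. \<exists>s\<in>{1..T}. (\<Sum>u<s. eps k u \<omega>) < - \<delta> * real s}"
  define tail where "tail i s = {\<omega> \<in> space M. (\<Delta> i - \<delta>) * real s \<le> (\<Sum>u<s. eps i u \<omega>)}" for i s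
  have \<Delta>: "0 \<le> \<Delta> i \<and> \<Delta> i \<le> 1" if "i \<in> S" for i using \<mu>[OF that] by (simp add: \<Delta>_def)
  have finB: "finite B" using S by (simp add: B_def)
  have finL: "finite L" using S by (simp add: L_def)
  have bad_meas[measurable]: "bad \<in> events"
    unfolding bad_def using countable_finite[OF finB] by measurable
  have tail_meas[measurable]: "tail i s \<in> events" for i s
    unfolding tail_def by measurable
  have h_meas: "h \<in> measurable M (count_space UNIV)"
    unfolding h_def X_def by (rule measurable_greedy_hist[OF _ S(1)]) measurable
  have hS: "h \<omega> ! t \<in> S" if "t < T" for \<omega> t
  proof -
    have "set (h \<omega>) \<subseteq> S" unfolding h_def by (rule set_greedy_hist[OF tb S])
    moreover have "length (h \<omega>) = T" by (simp add: h_def)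
    ultimately show ?thesis using that by (metis nth_mem subsetD)
  qed
  have int: "integrable M (\<lambda>\<omega>. \<Sum>t<T. f (h \<omega> ! t))" for f :: "nat \<Rightarrow> real"
  proof (intro Bochner_Integration.integrable_sum integrable_const_bound)
    fix t assume t: "t \<in> {..<T}"
    show "AE \<omega> in M. norm (f (h \<omega> ! t)) \<le> Max ((\<lambda>i. \<bar>f i\<bar>) ` S)"
      using S(1) hS t by (intro AE_I2) (auto intro: Max_ge)
    show "(\<lambda>\<omega>. f (h \<omega> ! t)) \<in> borel_measurable M"
      by (rule measurable_compose[OF h_meas]) simp
  qed
  have R: "?R = expectation (\<lambda>\<omega>. \<Sum>t<T. \<Delta> (h \<omega> ! t))"
  proof -
    have "expectation (\<lambda>\<omega>. \<Sum>t<T. \<Delta> (h \<omega> ! t)) = expectation (\<lambda>\<omega>. real T * m - (\<Sum>t<T. \<mu> (h \<omega> ! t)))"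
      by (simp add: \<Delta>_def sum_subtractf)
    also have "\<dots> = real T * m - expectation (\<lambda>\<omega>. \<Sum>t<T. \<mu> (h \<omega> ! t))"
      by (subst Bochner_Integration.integral_diff) (use int in \<open>simp_all add: prob_space\<close>)
    finally show ?thesis by (simp only: h_def X_def)
  qed
  show "?R \<le> real T"
  proof -
    have "expectation (\<lambda>\<omega>. \<Sum>t<T. \<Delta> (h \<omega> ! t)) \<le> expectation (\<lambda>_. real T)"
    proof (rule integral_mono[OF int])
      fix \<omega>
      have "(\<Sum>t<T. \<Delta> (h \<omega> ! t)) \<le> (\<Sum>t<T. 1)" using \<Delta> hS by (intro sum_mono) auto
      then show "(\<Sum>t<T. \<Delta> (h \<omega> ! t)) \<le> real T" by simp
    qed simp
    then show ?thesis unfolding R by (simp add: prob_space)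
  qed
  define U where "U \<omega> = real T * indicator bad \<omega> + 3 * \<delta> * real T
    + (\<Sum>i\<in>L. \<Delta> i * (1 + (\<Sum>s\<in>{1..T}. indicator (tail i s) \<omega>)))" for \<omega>
  have U: "(\<Sum>t<T. \<Delta> (h \<omega> ! t)) \<le> U \<omega>" if \<omega>: "\<omega> \<in> space M" for \<omega>
  proof -
    have X_sum: "(\<Sum>u<s. X \<omega> i u) = real s * \<mu> i + (\<Sum>u<s. eps i u \<omega>)" for i s
      by (simp add: X_def sum.distrib)
    have good: "(if \<exists>k\<in>B. \<forall>s\<in>{1..T}. (m - \<delta>) * real s \<le> (\<Sum>u<s. X \<omega> k u) then 0 else 1)
      = (indicator bad \<omega> :: real)"
    proof -
      have "(m - \<delta>) * real s \<le> (\<Sum>u<s. X \<omega> k u) \<longleftrightarrow> \<not> (\<Sum>u<s. eps k u \<omega>) < - \<delta> * real s"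
        if "k \<in> B" for k s
        using that unfolding X_sum B_def by (auto simp: algebra_simps)
      then show ?thesis using \<omega> by (auto simp: bad_def indicator_def)
    qed
    have tail: "(if (m - \<delta>) * real s \<le> (\<Sum>u<s. X \<omega> i u) then 1 else 0) = (indicator (tail i s) \<omega> :: real)" for i s
      using \<omega> unfolding X_sum by (simp add: tail_def \<Delta>_def indicator_def algebra_simps)
    have "B \<subseteq> S" by (auto simp: B_def)
    \<comment> \<open>With level \<open>m - \<delta>\<close>, an arm of gap above
      \<open>3 * \<delta>\<close> has to overshoot its own mean by
      \<open>\<Delta> i - \<delta> > 2 * \<delta>\<close>.\<close>
    from greedy_gap_sum_le[where d="3 * \<delta>" and T=T and X="X \<omega>" and c="m - \<delta>", OF tb S this \<Delta>] \<delta>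
    show ?thesis unfolding good tail U_def h_def L_def by simp
  qed
  have intI: "integrable M (\<lambda>\<omega>. indicator A \<omega> :: real)" if "A \<in> events" for A
    using that by (intro integrable_real_indicator) (auto simp: emeasure_eq_measure)
  have intU: "integrable M U"
    unfolding U_def
    by (intro Bochner_Integration.integrable_add integrable_mult_right Bochner_Integration.integrable_sum
        intI bad_meas tail_meas integrable_const)
  have "?R \<le> expectation U"
    unfolding R by (rule integral_mono[OF int intU U])
  also have "expectation U = real T * prob bad + 3 * \<delta> * real T
      + (\<Sum>i\<in>L. \<Delta> i * (1 + (\<Sum>s\<in>{1..T}. prob (tail i s))))"
  proof -
    have 1: "expectation (\<lambda>\<omega>. \<Delta> i * (1 + (\<Sum>s\<in>{1..T}. indicator (tail i s) \<omega>)))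
      = \<Delta> i * (1 + (\<Sum>s\<in>{1..T}. prob (tail i s)))" for i
    proof -
      have "expectation (\<lambda>\<omega>. 1 + (\<Sum>s\<in>{1..T}. indicator (tail i s) \<omega>) :: real)
        = expectation (\<lambda>\<omega>. 1) + expectation (\<lambda>\<omega>. \<Sum>s\<in>{1..T}. indicator (tail i s) \<omega>)"
        by (intro Bochner_Integration.integral_add integrable_const Bochner_Integration.integrable_sum intI tail_meas)
      also have "expectation (\<lambda>\<omega>. \<Sum>s\<in>{1..T}. indicator (tail i s) \<omega>) = (\<Sum>s\<in>{1..T}. expectation (indicator (tail i s)) :: real)"
        by (intro Bochner_Integration.integral_sum intI tail_meas)
      finally show ?thesis by (simp add: prob_space)
    qed
    have 2: "integrable M (\<lambda>\<omega>. \<Delta> i * (1 + (\<Sum>s\<in>{1..T}. indicator (tail i s) \<omega>)))" for i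
      by (intro Bochner_Integration.integrable_add integrable_mult_right Bochner_Integration.integrable_sum
        intI tail_meas integrable_const)
    have "expectation U = expectation (\<lambda>\<omega>. real T * indicator bad \<omega> + 3 * \<delta> * real T)
        + expectation (\<lambda>\<omega>. \<Sum>i\<in>L. \<Delta> i * (1 + (\<Sum>s\<in>{1..T}. indicator (tail i s) \<omega>)))"
      unfolding U_def
      by (intro Bochner_Integration.integral_add integrable_const Bochner_Integration.integrable_add
          Bochner_Integration.integrable_sum integrable_mult_right intI bad_meas 2)
    also have "expectation (\<lambda>\<omega>. real T * indicator bad \<omega> + 3 * \<delta> * real T)
        = expectation (\<lambda>\<omega>. real T * indicator bad \<omega>) + expectation (\<lambda>\<omega>. 3 * \<delta> * real T)"
      by (intro Bochner_Integration.integral_add integrable_const integrable_mult_right intI bad_meas)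
    also have "expectation (\<lambda>\<omega>. \<Sum>i\<in>L. \<Delta> i * (1 + (\<Sum>s\<in>{1..T}. indicator (tail i s) \<omega>)))
        = (\<Sum>i\<in>L. \<Delta> i * (1 + (\<Sum>s\<in>{1..T}. prob (tail i s))))"
      unfolding 1[symmetric] by (rule Bochner_Integration.integral_sum[OF 2])
    finally show ?thesis by (simp add: prob_space)
  qed
  also have "prob bad \<le> exp (- \<delta>\<^sup>2 / 2) ^ card B"
  proof -
    define A where "A = {z :: nat \<Rightarrow> real. \<exists>s\<in>{1..T}. (\<Sum>u<s. z u) < - \<delta> * real s}"
    have A: "A \<in> sets (PiM UNIV (\<lambda>_. borel))"
    proof -
      have "{z \<in> space (PiM UNIV (\<lambda>_. borel)). \<exists>s\<in>{1..T}. (\<Sum>u<s. z u) < - \<delta> * real s}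
        \<in> sets (PiM (UNIV :: nat set) (\<lambda>_. borel :: real measure))" by measurable
      then show ?thesis by (simp add: A_def space_PiM)
    qed
    have "prob bad = prob {\<omega> \<in> space M. \<forall>k\<in>B. (\<lambda>s. eps k s \<omega>) \<in> A}"
      by (simp add: bad_def A_def)
    also have "\<dots> = (\<Prod>k\<in>B. prob {\<omega> \<in> space M. (\<lambda>s. eps k s \<omega>) \<in> A})"
      by (rule indep_rows_prob_all[OF ind finB A])
    also have "\<dots> \<le> (\<Prod>k\<in>B. exp (- \<delta>\<^sup>2 / 2))"
    proof (intro prod_mono conjI measure_nonneg)
      fix k
      show "prob {\<omega> \<in> space M. (\<lambda>s. eps k s \<omega>) \<in> A} \<le> exp (- \<delta>\<^sup>2 / 2)"
        using subgaussian_mean_maximal_ineq[where N=T and \<delta>=\<delta>, OF row[of k] row_ident sub] \<delta>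
        by (simp add: A_def)
    qed
    finally show ?thesis by simp
  qed
  also have "(\<Sum>i\<in>L. \<Delta> i * (1 + (\<Sum>s\<in>{1..T}. prob (tail i s)))) \<le> (\<Sum>i\<in>L. 1 + 3 / (2 * \<delta>))"
  proof (rule sum_mono)
    fix i assume "i \<in> L"
    then have i: "i \<in> S" "3 * \<delta> < \<Delta> i" by (auto simp: L_def)
    define d where "d = \<Delta> i - \<delta>"
    have d: "2 * \<delta> < d" "0 < d" using i \<delta> by (auto simp: d_def)
    have "(\<Sum>s\<in>{1..T}. prob (tail i s)) \<le> (\<Sum>s\<in>{1..T}. exp (- (d\<^sup>2 / 2)) ^ s)"
      using subgaussian_sum_tail[OF row sub d(2)] by (intro sum_mono) (simp add: tail_def d_def)
    also have "\<dots> \<le> 1 / (d\<^sup>2 / 2)" using d by (intro sum_exp_power_le) simp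
    finally have "\<Delta> i * (1 + (\<Sum>s\<in>{1..T}. prob (tail i s))) \<le> \<Delta> i * (1 + 1 / (d\<^sup>2 / 2))"
      using \<Delta>[OF i(1)] by (intro mult_left_mono) auto
    also have "\<dots> = \<Delta> i + 2 * \<Delta> i / d\<^sup>2" by (simp add: algebra_simps)
    also have "\<dots> \<le> 1 + 3 / (2 * \<delta>)"
    proof (rule add_mono)
      \<comment> \<open>From \<open>3 * \<delta> < \<Delta> i\<close>, the overshoot
        \<open>d = \<Delta> i - \<delta>\<close> is at least two thirds of the gap. Dividing by
        \<open>d\<^sup>2\<close> therefore leaves only order \<open>1 / \<delta>\<close>.\<close>
      have "2 * \<Delta> i \<le> 3 * d" using i \<delta> by (simp add: d_def)
      then have "2 * \<Delta> i / d\<^sup>2 \<le> 3 * d / d\<^sup>2" by (intro divide_right_mono) auto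
      also have "\<dots> = 3 / d" using d by (simp add: power2_eq_square)
      also have "\<dots> \<le> 3 / (2 * \<delta>)" using d \<delta> by (intro divide_left_mono) auto
      finally show "2 * \<Delta> i / d\<^sup>2 \<le> 3 / (2 * \<delta>)" .
    qed (use \<Delta>[OF i(1)] in simp)
    finally show "\<Delta> i * (1 + (\<Sum>s\<in>{1..T}. prob (tail i s))) \<le> 1 + 3 / (2 * \<delta>)" .
  qed
  also have "(\<Sum>i\<in>L. 1 + 3 / (2 * \<delta>)) \<le> real (card S) * (1 + 3 / (2 * \<delta>))"
    using card_mono[OF S(1), of L] \<delta> by (auto simp: L_def intro!: mult_right_mono)
  finally show "?R \<le> real T * exp (- \<delta>\<^sup>2 / 2) ^ card {i\<in>S. \<mu> i = m} + 3 * \<delta> * real T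
      + real (card S) * (1 + 3 / (2 * \<delta>))"
    by (simp add: B_def mult_left_mono)
qed

text \<open>The regret is the plain average over all \<open>K\<close>-subsets of the regret for a
  fixed subset. In the bound only the failure term varies with the subset, through its number of
  best arms, and \<open>hypergeometric_pgf_le\<close> averages it.\<close>

lemma (in prob_space) subsampled_greedy_regret_le:
  fixes eps :: "nat \<Rightarrow> nat \<Rightarrow> 'a \<Rightarrow> real" and \<mu> :: "nat \<Rightarrow> real"
  assumes ind: "indep_vars (\<lambda>_. borel) (\<lambda>p. eps (fst p) (snd p)) UNIV"
    and ident: "\<And>i s. distr M borel (eps i s) = distr M borel (eps 0 0)"
    and sub: "\<And>i s. subgaussian M 1 (eps i s)"
    and tb: "valid_tiebreak tb" and K: "1 \<le> K" "K \<le> n"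
    and \<mu>: "\<And>i. i < n \<Longrightarrow> 0 \<le> \<mu> i \<and> \<mu> i \<le> 1"
  shows "subsampled_greedy_regret M eps n \<mu> tb K T \<le> real T"
    and "0 < \<delta> \<Longrightarrow> subsampled_greedy_regret M eps n \<mu> tb K T
      \<le> real T * exp (- (real K * (real (num_best n \<mu>) / real n) * (1 - exp (- \<delta>\<^sup>2 / 2))))
        + 3 * \<delta> * real T + real K * (1 + 3 / (2 * \<delta>))"
proof -
  define m where "m = best_mean n \<mu>"
  define F where "F = {S. S \<subseteq> {..<n} \<and> card S = K}"
  define C where "C = real (n choose K)"
  define G where "G S = (\<integral>\<omega>. (\<Sum>t<T. \<mu> (greedy_hist tb S (\<lambda>i s. \<mu> i + eps i s \<omega>) T ! t)) \<partial>M)" for S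
  define B where "B = {i. i < n \<and> \<mu> i = m}"
  have finF: "finite F" by (simp add: F_def)
  have cardF: "real (card F) = C"
    unfolding F_def C_def using n_subsets[of "{..<n}" K] by simp
  have C: "0 < C" using K by (simp add: C_def)
  have F_ne: "F \<noteq> {}" using cardF C by auto
  have m_ge: "\<mu> i \<le> m" if "i < n" for i
    unfolding m_def best_mean_def using that by (intro Max_ge) auto
  have "m \<in> \<mu> ` {..<n}"
    unfolding m_def best_mean_def using K by (intro Max_in) (auto simp: lessThan_empty_iff)
  then have m1: "m \<le> 1" using \<mu> by auto
  have gap: "\<mu> i \<le> m \<and> m - \<mu> i \<le> 1" if "S \<in> F" "i \<in> S" for S i
  proof -
    have "i < n" using that by (auto simp: F_def)
    then show ?thesis using m_ge[of i] m1 \<mu>[of i] by simp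
  qed
  have S: "finite S" "S \<noteq> {}" if "S \<in> F" for S
    using that K by (auto simp: F_def intro: finite_subset)
  have regret: "subsampled_greedy_regret M eps n \<mu> tb K T = (\<Sum>S\<in>F. real T * m - G S) / C"
  proof -
    have "subsampled_greedy_regret M eps n \<mu> tb K T = real T * m - (\<Sum>S\<in>F. G S) / C"
      unfolding subsampled_greedy_regret_def m_def[symmetric] F_def[symmetric] G_def[symmetric]
      using integral_pmf_of_set[OF F_ne finF, of G] cardF by simp
    also have "\<dots> = (\<Sum>S\<in>F. real T * m - G S) / C"
      using C cardF by (simp add: sum_subtractf diff_divide_distrib)
    finally show ?thesis .
  qed
  have "(\<Sum>S\<in>F. real T * m - G S) \<le> (\<Sum>S\<in>F. real T)"
    unfolding G_def using gap S by (intro sum_mono greedy_regret_le(2)[where \<delta>=1, OF ind ident sub tb]) auto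
  then have "(\<Sum>S\<in>F. real T * m - G S) \<le> C * real T" by (simp add: cardF)
  then show "subsampled_greedy_regret M eps n \<mu> tb K T \<le> real T"
    unfolding regret using C by (simp add: pos_divide_le_eq mult.commute)
  assume \<delta>: "0 < \<delta>"
  define q where "q = exp (- \<delta>\<^sup>2 / 2)"
  define b where "b = 3 * \<delta> * real T + real K * (1 + 3 / (2 * \<delta>))"
  have "real T * m - G S \<le> real T * q ^ card (S \<inter> B) + b" if "S \<in> F" for S
  proof -
    have "{i\<in>S. \<mu> i = m} = S \<inter> B" using that by (auto simp: F_def B_def)
    moreover have "card S = K" using that by (simp add: F_def)
    moreover note greedy_regret_le(1)[where T=T and \<mu>=\<mu> and m=m, OF ind ident sub tb S[OF that] gap[OF that] \<delta>]
    ultimately show ?thesis by (simp add: G_def q_def b_def add.assoc)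
  qed
  then have "(\<Sum>S\<in>F. real T * m - G S) \<le> (\<Sum>S\<in>F. real T * q ^ card (S \<inter> B) + b)"
    by (intro sum_mono) auto
  also have "\<dots> = real T * (\<Sum>S\<in>F. q ^ card (S \<inter> B)) + C * b"
    by (simp add: sum.distrib sum_distrib_left cardF)
  also have "(\<Sum>S\<in>F. q ^ card (S \<inter> B)) \<le> C * exp (- (real K * (real (card B) / real n) * (1 - q)))"
    unfolding F_def C_def by (rule hypergeometric_pgf_le) (use K in \<open>auto simp: B_def q_def\<close>)
  finally have "(\<Sum>S\<in>F. real T * m - G S)
      \<le> real T * (C * exp (- (real K * (real (card B) / real n) * (1 - q)))) + C * b"
    by (simp add: mult_left_mono)
  also have "\<dots> = C * (real T * exp (- (real K * (real (card B) / real n) * (1 - q))) + b)"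
    by (simp add: distrib_left)
  finally have "(\<Sum>S\<in>F. real T * m - G S)
      \<le> C * (real T * exp (- (real K * (real (card B) / real n) * (1 - q))) + b)" .
  then have "subsampled_greedy_regret M eps n \<mu> tb K T
      \<le> real T * exp (- (real K * (real (card B) / real n) * (1 - q))) + b"
    unfolding regret using C by (simp add: pos_divide_le_eq mult.commute)
  moreover have "card B = num_best n \<mu>" by (simp add: B_def num_best_def m_def)
  ultimately show "subsampled_greedy_regret M eps n \<mu> tb K T
      \<le> real T * exp (- (real K * (real (num_best n \<mu>) / real n) * (1 - exp (- \<delta>\<^sup>2 / 2))))
        + 3 * \<delta> * real T + real K * (1 + 3 / (2 * \<delta>))"
    by (simp add: b_def q_def add.assoc)
qed

section \<open>Tuning and explicit constants\<close>

text \<open>Since \<open>exp (- y) \<le> 1 / (1 + y)\<close>, the right side is at least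
  \<open>y / (1 + y)\<close>, and \<open>1 + y \<le> 2\<close>.\<close>

lemma half_le_one_minus_exp_neg:
  fixes y :: real
  assumes "0 \<le> y" "y \<le> 1"
  shows "y / 2 \<le> 1 - exp (- y)"
proof -
  have "exp (- y) \<le> 1 / (1 + y)"
    using exp_ge_add_one_self[of y] assms by (simp add: exp_minus divide_simps)
  moreover have "y / 2 \<le> 1 - 1 / (1 + y)"
    using assms mult_left_mono[of y 1 y] by (simp add: field_simps)
  ultimately show ?thesis by linarith
qed

text \<open>Lets a square root of the logarithmic factor be replaced by the factor itself, so that
  all terms of the final bounds share one scale.\<close>

lemma sqrt_two_mult_le:
  fixes x :: real
  assumes "1 \<le> x"
  shows "sqrt (2 * x) \<le> 3 / 2 * x"
proof (rule real_le_lsqrt)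
  have "2 * x \<le> 2 * x * x" using assms by (simp add: mult_le_cancel_left1)
  also have "\<dots> \<le> (3 / 2 * x)\<^sup>2" by (simp add: power2_eq_square)
  finally show "2 * x \<le> (3 / 2 * x)\<^sup>2" .
qed (use assms in auto)

text \<open>The choice \<open>\<delta> = sqrt (2 * a / t)\<close> balances \<open>\<delta> * t\<close> against \<open>a / \<delta>\<close>.\<close>
lemma regret_bound_balanced:
  fixes R a t k p :: real
  assumes bound: "\<And>\<delta>. 0 < \<delta> \<Longrightarrow>
      R \<le> t * exp (- (k * p * (1 - exp (- \<delta>\<^sup>2 / 2)))) + 3 * \<delta> * t + k * (1 + 3 / (2 * \<delta>))"
    and t: "0 < t" and a: "1 \<le> a" and k: "2 * a \<le> k" "k \<le> 2 * a + 1" and p: "0 \<le> p"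
    and explore: "ln t \<le> 2 * a * p * (1 - exp (- (a / t)))"
  shows "R \<le> 2 + 2 * a + 21 / 4 * sqrt (2 * a * t)"
proof -
  define \<delta> where "\<delta> = sqrt (2 * a / t)"
  have \<delta>: "0 < \<delta>" using t a by (simp add: \<delta>_def)
  have \<delta>2: "\<delta>\<^sup>2 = 2 * a / t" using t a by (simp add: \<delta>_def)
  then have \<delta>2t: "\<delta> * \<delta> * t = 2 * a" using t by (simp add: power2_eq_square)
  have \<delta>t: "\<delta> * t = sqrt (2 * a * t)"
  proof (rule real_sqrt_unique[symmetric])
    show "(\<delta> * t)\<^sup>2 = 2 * a * t"
      unfolding \<delta>2t[symmetric] by (simp add: power2_eq_square mult_ac)
    show "0 \<le> \<delta> * t" using \<delta> t by simp
  qed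
  have a_\<delta>: "a / \<delta> = \<delta> * t / 2" using \<delta>2t \<delta> by (simp add: field_simps)
  \<comment> \<open>As \<open>\<delta>\<^sup>2 / 2 = a / t\<close>, the hypothesis
    \<open>explore\<close> says that the failure exponent is at least \<open>ln t\<close>, so the
    failure term costs at most 1.\<close>
  have "0 \<le> 1 - exp (- (a / t))" using a t by simp
  then have "2 * a * (p * (1 - exp (- (a / t)))) \<le> k * (p * (1 - exp (- (a / t))))"
    using k p by (intro mult_right_mono mult_nonneg_nonneg) auto
  with explore have "ln t \<le> k * p * (1 - exp (- \<delta>\<^sup>2 / 2))"
    by (simp add: \<delta>2 mult.assoc)
  then have "t * exp (- (k * p * (1 - exp (- \<delta>\<^sup>2 / 2)))) \<le> t * exp (- ln t)"
    using t by (intro mult_left_mono) auto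
  also have "\<dots> = 1" using t by (simp add: exp_minus)
  finally have 1: "t * exp (- (k * p * (1 - exp (- \<delta>\<^sup>2 / 2)))) \<le> 1" .
  \<comment> \<open>Rounding adds at most 1 to \<open>2 * a\<close>; its share
    \<open>3 / (2 * \<delta>)\<close> is absorbed using \<open>1 \<le> a\<close>. The coefficient of
    \<open>\<delta> * t\<close> becomes \<open>9 / 4\<close> here and
    \<open>3 + 9 / 4 = 21 / 4\<close> in total.\<close>
  have "k * (1 + 3 / (2 * \<delta>)) \<le> (2 * a + 1) * (1 + 3 / (2 * \<delta>))"
    using k \<delta> by (intro mult_right_mono) auto
  also have "\<dots> = 2 * a + 1 + 3 * (a / \<delta>) + 3 / 2 * (1 / \<delta>)"
    by (simp add: algebra_simps add_divide_distrib)
  also have "\<dots> \<le> 2 * a + 1 + 3 * (a / \<delta>) + 3 / 2 * (a / \<delta>)"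
    using a \<delta> by (intro add_left_mono mult_left_mono divide_right_mono) auto
  finally have 2: "k * (1 + 3 / (2 * \<delta>)) \<le> 2 * a + 1 + 9 / 4 * (\<delta> * t)" unfolding a_\<delta> by simp
  show ?thesis using bound[OF \<delta>] 1 2 unfolding \<delta>t[symmetric] by simp
qed

text \<open>For \<open>\<gamma> > 1/2\<close> the claimed bound exceeds \<open>t\<close>, hence is
  implied by \<open>Rt\<close>. Otherwise the balanced bound applies with
  \<open>a = t powr (2 * \<gamma>) * ln t\<close>.\<close>

lemma regret_bound_large_gamma:
  fixes R \<gamma> t k p :: real
  assumes bound: "\<And>\<delta>. 0 < \<delta> \<Longrightarrow>
      R \<le> t * exp (- (k * p * (1 - exp (- \<delta>\<^sup>2 / 2)))) + 3 * \<delta> * t + k * (1 + 3 / (2 * \<delta>))"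
    and Rt: "R \<le> t" and t: "1 < t" and L: "1 \<le> ln t" and \<gamma>: "0 \<le> \<gamma>"
    and p: "t powr - \<gamma> \<le> p"
    and le: "t powr (1 - 3 * \<gamma>) \<le> ln t"
    and k: "2 * (t powr (2 * \<gamma>) * ln t) \<le> k" "k \<le> 2 * (t powr (2 * \<gamma>) * ln t) + 1"
  shows "R \<le> 14 * t powr (\<gamma> + 1/2) * ln t + 2"
proof (cases "\<gamma> \<le> 1/2")
  case True
  define L where "L = ln t"
  define D where "D = t powr (\<gamma> + 1/2)"
  define a where "a = t powr (2 * \<gamma>) * L"
  define y where "y = t powr - \<gamma>"
  have L1: "1 \<le> L" using L by (simp add: L_def)
  have "t powr 0 \<le> t powr (2 * \<gamma>)" using t \<gamma> by (intro powr_mono) auto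
  then have a1: "1 \<le> a" using L1 mult_mono[of 1 "t powr (2 * \<gamma>)" 1 L] t by (simp add: a_def)
  have D0: "0 \<le> D" by (simp add: D_def)
  have aD: "a \<le> L * D"
    unfolding a_def D_def mult.commute[of L] using t True L1 by (intro mult_right_mono powr_mono) auto
  have "t powr - \<gamma> \<le> t powr 0" using t \<gamma> by (intro powr_mono) auto
  then have y: "0 \<le> y" "y \<le> 1" using t by (auto simp: y_def)
  \<comment> \<open>The case hypothesis \<open>le\<close> amounts to \<open>y \<le> a / t\<close>.
    Since \<open>a / t\<close> may exceed 1, the linear lower bound on \<open>1 - exp (- x)\<close>
    is used at \<open>y \<le> 1\<close> instead.\<close>
  have "y = t powr (2 * \<gamma> - 1) * t powr (1 - 3 * \<gamma>)"
    by (simp add: y_def powr_add[symmetric])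
  also have "\<dots> \<le> t powr (2 * \<gamma> - 1) * L" using le by (intro mult_left_mono) (auto simp: L_def)
  also have "\<dots> = a / t" using t by (simp add: a_def powr_diff)
  finally have ya: "y \<le> a / t" .
  have p0: "0 \<le> p" using order_trans[OF _ p, of 0] by simp
  have "L = 2 * a * y * (y / 2)"
    using t by (simp add: a_def y_def powr_add[symmetric] mult_ac)
  also have "\<dots> \<le> 2 * a * p * (1 - exp (- (a / t)))"
  proof (intro mult_mono)
    have "1 - exp (- y) \<le> 1 - exp (- (a / t))" using ya by simp
    with half_le_one_minus_exp_neg[OF y] show "y / 2 \<le> 1 - exp (- (a / t))" by linarith
  qed (use p p0 y a1 in \<open>auto simp: y_def\<close>)
  finally have explore: "ln t \<le> 2 * a * p * (1 - exp (- (a / t)))" by (simp add: L_def)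
  have "2 * a \<le> k" "k \<le> 2 * a + 1" using k by (simp_all add: a_def L_def)
  from regret_bound_balanced[OF bound _ a1 this p0 explore] t
  have "R \<le> 2 + 2 * a + 21 / 4 * sqrt (2 * a * t)" by simp
  also have "2 * a * t = 2 * L * D\<^sup>2"
    using t by (simp add: a_def D_def powr_add[symmetric] powr_power powr_mult_base algebra_simps)
  also have "sqrt (2 * L * D\<^sup>2) = sqrt (2 * L) * D" using D0 by (simp add: real_sqrt_mult)
  also have "\<dots> \<le> 3 / 2 * L * D" using D0 by (intro mult_right_mono sqrt_two_mult_le L1)
  finally have "R \<le> 2 + 2 * a + 21 / 4 * (3 / 2 * L * D)" by simp
  \<comment> \<open>The coefficients add up to \<open>2 + 63 / 8\<close>, below 14.\<close>
  also have "\<dots> \<le> 14 * (L * D) + 2" using aD a1 by simp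
  finally show ?thesis by (simp add: L_def D_def mult_ac)
next
  case False
  then have "t powr 1 \<le> t powr (\<gamma> + 1/2)" using t by (intro powr_mono) auto
  then have "t \<le> t powr (\<gamma> + 1/2) * 1" using t by simp
  also have "\<dots> \<le> t powr (\<gamma> + 1/2) * ln t" using L by (intro mult_left_mono) auto
  finally show ?thesis using Rt t by simp
qed

text \<open>With \<open>a = sqrt (t powr (1 + \<gamma>) * ln t)\<close>, the product
  \<open>a\<^sup>2 * t powr - \<gamma> / t\<close> equals \<open>ln t\<close>, which is exactly the
  exploration requirement once \<open>1 - exp (- (a / t))\<close> is bounded below by
  \<open>a / t / 2\<close>. The hypothesis \<open>ge\<close> supplies the needed
  \<open>a \<le> t\<close>.\<close>

lemma regret_bound_small_gamma:
  fixes R \<gamma> t k p :: real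
  assumes bound: "\<And>\<delta>. 0 < \<delta> \<Longrightarrow>
      R \<le> t * exp (- (k * p * (1 - exp (- \<delta>\<^sup>2 / 2)))) + 3 * \<delta> * t + k * (1 + 3 / (2 * \<delta>))"
    and t: "1 < t" and L: "1 \<le> ln t" and \<gamma>: "0 \<le> \<gamma>" "\<gamma> \<le> 1"
    and p: "t powr - \<gamma> \<le> p"
    and ge: "ln t \<le> t powr (1 - 3 * \<gamma>)"
    and k: "2 * sqrt (t powr (1 + \<gamma>) * ln t) \<le> k" "k \<le> 2 * sqrt (t powr (1 + \<gamma>) * ln t) + 1"
  shows "R \<le> 14 * t powr ((3 + \<gamma>) / 4) * sqrt (ln t) + 2"
proof -
  define s where "s = sqrt (ln t)"
  define D where "D = t powr ((3 + \<gamma>) / 4)"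
  define a where "a = sqrt (t powr (1 + \<gamma>) * ln t)"
  have s1: "1 \<le> s" using L by (simp add: s_def)
  have s2: "s\<^sup>2 = ln t" using L by (simp add: s_def)
  have a_eq: "a = t powr ((1 + \<gamma>) / 2) * s"
    using t by (simp add: a_def s_def real_sqrt_mult powr_half_sqrt[symmetric] powr_powr)
  have a2: "a\<^sup>2 = t powr (1 + \<gamma>) * ln t" using L by (simp add: a_def)
  have "t powr 0 \<le> t powr ((1 + \<gamma>) / 2)" using t \<gamma> by (intro powr_mono) auto
  then have a1: "1 \<le> a" using s1 mult_mono[of 1 "t powr ((1 + \<gamma>) / 2)" 1 s] t by (simp add: a_eq)
  have D0: "0 \<le> D" by (simp add: D_def)
  have aD: "a \<le> s * D"
    unfolding a_eq D_def mult.commute[of s] using t \<gamma> s1 by (intro mult_right_mono powr_mono) auto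
  have "a\<^sup>2 \<le> t powr (1 + \<gamma>) * t powr (1 - 3 * \<gamma>)"
    unfolding a2 using ge by (intro mult_left_mono) auto
  also have "\<dots> = t powr (2 - 2 * \<gamma>)" by (simp add: powr_add[symmetric])
  also have "\<dots> \<le> t powr 2" using t \<gamma> by (intro powr_mono) auto
  also have "\<dots> = t\<^sup>2" using t by simp
  finally have "a \<le> t" using t by (simp add: power2_le_iff_abs_le)
  then have y: "0 \<le> a / t" "a / t \<le> 1" using t a1 by auto
  have "ln t = t powr (1 + \<gamma>) * ln t * (t powr - \<gamma> / t)"
    using t by (simp add: powr_add powr_minus field_simps)
  also have "\<dots> = 2 * a * t powr - \<gamma> * (a / t / 2)"
    unfolding a2[symmetric] by (simp add: power2_eq_square)
  also have "\<dots> \<le> 2 * a * p * (1 - exp (- (a / t)))"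
    using p a1 y order_trans[OF _ p, of 0]
    by (intro mult_mono half_le_one_minus_exp_neg mult_nonneg_nonneg) auto
  finally have explore: "ln t \<le> 2 * a * p * (1 - exp (- (a / t)))" .
  have "0 \<le> p" using order_trans[OF _ p, of 0] by simp
  have "2 * a \<le> k" "k \<le> 2 * a + 1" using k by (simp_all add: a_def)
  from regret_bound_balanced[OF bound _ a1 this \<open>0 \<le> p\<close> explore] t
  have "R \<le> 2 + 2 * a + 21 / 4 * sqrt (2 * a * t)" by simp
  also have "2 * a * t = 2 * s * D\<^sup>2"
  proof -
    have "D\<^sup>2 = t powr ((1 + \<gamma>) / 2 + 1)"
    proof -
      have "(3 + \<gamma>) / 4 + (3 + \<gamma>) / 4 = (1 + \<gamma>) / 2 + 1" by (simp add: field_simps)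
      then show ?thesis unfolding D_def power2_eq_square powr_add[symmetric] by (rule arg_cong)
    qed
    then show ?thesis using t by (simp add: a_eq powr_add)
  qed
  also have "sqrt (2 * s * D\<^sup>2) = sqrt (2 * s) * D" using D0 by (simp add: real_sqrt_mult)
  also have "\<dots> \<le> 3 / 2 * s * D" using D0 by (intro mult_right_mono sqrt_two_mult_le s1)
  finally have "R \<le> 2 + 2 * a + 21 / 4 * (3 / 2 * s * D)" by simp
  also have "\<dots> \<le> 14 * (s * D) + 2" using aD a1 by simp
  finally show ?thesis by (simp add: s_def D_def mult_ac)
qed

text \<open>The hypothesis on \<open>n / m\<close> enters as a lower bound
  \<open>T powr - \<gamma>\<close> on the fraction of best arms. The real-valued choices of
  \<open>K\<close> are rounded up.\<close>

theorem theorem8: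
  fixes M :: "'a measure" and eps :: "nat \<Rightarrow> nat \<Rightarrow> 'a \<Rightarrow> real"
    and n K T :: nat and \<mu> :: "nat \<Rightarrow> real" and \<gamma> :: real
    and tb :: "nat list \<Rightarrow> nat set \<Rightarrow> nat"
  assumes "prob_space M"
    and "prob_space.indep_vars M (\<lambda>_. borel) (\<lambda>p. eps (fst p) (snd p)) UNIV"
    and "\<And>i s. distr M borel (eps i s) = distr M borel (eps 0 0)"
    and "\<And>i s. subgaussian M 1 (eps i s)"
    and "\<And>i. i < n \<Longrightarrow> 0 \<le> \<mu> i \<and> \<mu> i \<le> 1"
    and "0 \<le> \<gamma>" and "\<gamma> \<le> 1"
    and "real n / real (num_best n \<mu>) \<le> real T powr \<gamma>"
    and "valid_tiebreak tb"
    and "1 \<le> K" and "K \<le> n"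
  shows "(real T powr (1 - 3 * \<gamma>) \<le> ln (real T) \<longrightarrow>
            K = nat \<lceil>2 * real T powr (2 * \<gamma>) * ln (real T)\<rceil> \<longrightarrow>
            subsampled_greedy_regret M eps n \<mu> tb K T
              \<le> 14 * real T powr (\<gamma> + 1/2) * ln (real T) + 2)
       \<and> (\<not> real T powr (1 - 3 * \<gamma>) \<le> ln (real T) \<longrightarrow>
            K = nat \<lceil>2 * sqrt (real T powr (1 + \<gamma>) * ln (real T))\<rceil> \<longrightarrow>
            subsampled_greedy_regret M eps n \<mu> tb K T
              \<le> 14 * real T powr ((3 + \<gamma>) / 4) * sqrt (ln (real T)) + 2)"
proof -
  interpret prob_space M by fact
  define R where "R = subsampled_greedy_regret M eps n \<mu> tb K T"
  define t where "t = real T"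
  define p where "p = real (num_best n \<mu>) / real n"
  have n: "0 < n" using assms(10,11) by simp
  have "best_mean n \<mu> \<in> \<mu> ` {..<n}"
    unfolding best_mean_def using n by (intro Max_in) (auto simp: lessThan_empty_iff)
  then have "{i. i < n \<and> \<mu> i = best_mean n \<mu>} \<noteq> {}" by auto
  then have m: "0 < num_best n \<mu>" unfolding num_best_def by (subst card_gt_0_iff) simp
  note regret = subsampled_greedy_regret_le[where T=T and \<mu>=\<mu> and n=n, OF assms(2-4,9-11,5), folded R_def p_def t_def]
  have "real n / real (num_best n \<mu>) \<le> t powr \<gamma>" using assms(8) by (simp add: t_def)
  moreover from this have t0: "0 < t powr \<gamma>"
    using n m by (meson divide_pos_pos less_le_trans of_nat_0_less_iff)
  ultimately have p: "t powr - \<gamma> \<le> p"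
    using n m unfolding p_def powr_minus by (simp add: field_simps)
  \<comment> \<open>The convention \<open>0 powr \<gamma> = 0\<close> excludes \<open>T = 0\<close>,
    because \<open>n / m\<close> is positive.\<close>
  have "t \<noteq> 0" using t0 by auto
  then have t1: "1 \<le> t" by (simp add: t_def)
  \<comment> \<open>For \<open>T \<le> 2\<close> the additive constant 2 already covers the regret;
    from \<open>T = 3\<close> on, \<open>ln T \<ge> 1\<close> because
    \<open>exp 1 \<le> 3\<close>.\<close>
  have R2: ?thesis if "T \<le> 2"
  proof -
    have "R \<le> 2" using regret(1) that by (simp add: t_def)
    moreover have "0 \<le> 14 * t powr (\<gamma> + 1/2) * ln t" "0 \<le> 14 * t powr ((3 + \<gamma>) / 4) * sqrt (ln t)"
      using t1 by auto
    ultimately show ?thesis unfolding R_def[symmetric] t_def[symmetric] by linarith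
  qed
  have ceil: "x \<le> real (nat \<lceil>x\<rceil>) \<and> real (nat \<lceil>x\<rceil>) \<le> x + 1" if "0 \<le> x" for x :: real
    using that by linarith
  show ?thesis
  proof (cases "T \<le> 2")
    case False
    then have "3 \<le> t" by (simp add: t_def)
    then have t: "1 < t" and L: "1 \<le> ln t"
      using exp_le by (auto simp: ln_ge_iff)
    show ?thesis
      unfolding R_def[symmetric] t_def[symmetric]
    proof (intro conjI impI)
      assume le: "t powr (1 - 3 * \<gamma>) \<le> ln t" and K: "K = nat \<lceil>2 * t powr (2 * \<gamma>) * ln t\<rceil>"
      show "R \<le> 14 * t powr (\<gamma> + 1/2) * ln t + 2"
        by (rule regret_bound_large_gamma[OF regret(2) regret(1) t L assms(6) p le])
          (use ceil[of "2 * t powr (2 * \<gamma>) * ln t"] K L in \<open>simp_all add: mult.assoc\<close>)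
    next
      assume "\<not> t powr (1 - 3 * \<gamma>) \<le> ln t" and K: "K = nat \<lceil>2 * sqrt (t powr (1 + \<gamma>) * ln t)\<rceil>"
      then have ge: "ln t \<le> t powr (1 - 3 * \<gamma>)" by simp
      show "R \<le> 14 * t powr ((3 + \<gamma>) / 4) * sqrt (ln t) + 2"
        by (rule regret_bound_small_gamma[OF regret(2) t L assms(6,7) p ge])
          (use ceil[of "2 * sqrt (t powr (1 + \<gamma>) * ln t)"] K L in simp_all)
    qed
  qed (rule R2)
qed

end
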